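(* Suppose that the short-term optimum $(q^{\mathrm{SO}},p^{\mathrm{SO}},\lambda^{\mathrm{SO}})$ satisfies the positivity/convexity assumption stated in the context, and that $$-1<\dot c_k(t)<\frac{\mu_i-\mu_{i+1}}{\mu_{i+1}}\qquad\text{for all } k\in\mathcal K,\ i\in\mathcal I^*,\ t\in\mathcal T$$ (wherever the derivative exists, the upper bound being vacuous for $i=i^*$). Then the following variables are a solution to the short-term equilibrium problem: $w^{\mathrm{UE}}_i(t)=p^{\mathrm{SO}}_i(t)$ for all $i,t$; $\lambda^{\mathrm{UE}}_i(h)=\lambda^{\mathrm{SO}}_i(h)$ for all $h,i$; $\mathcal T^{\mathrm{UE}}_i=\mathcal T^{\mathrm{SO}}_i$ for all $i$; and any nonnegative $q^{\mathrm{UE}}_{i,k}(h,t)$ with $$\int_{\mathcal H}h\,q^{\mathrm{UE}}_{i,k}(h,t)\,dh=\begin{cases}\mu_i\dot\sigma^{\mathrm{UE}}_i(t)-\mu_{i+1}\dot\sigma^{\mathrm{UE}}_{i+1}(t)&\text{if } t\in\mathcal T^{\mathrm{UE}}_i\cap\widehat{\mathcal T}_k,\\0&\text{otherwise,}\end{cases}$$ for all $k\in\mathcal K$, $i\in\mathcal I^*$ (and almost every $t$), with $q^{\mathrm{UE}}_{i,k}(h,t)=0$ for $t\notin \mathcal T^{\mathrm{UE}}_i\cap\widehat{\mathcal T}_k$, and $$\sum_{k\in\mathcal K}\int_{\mathcal T}q^{\mathrm{UE}}_{i,k}(h,t)\,dt=Q_i(h)\qquad\text{for all } i\in\mathcal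 I^*,\ h\in\mathcal H.$$ Here $\sigma_i^{\mathrm{UE}}(t)=t-\sum_{j<i}(w_j^{\mathrm{UE}}(t)+f_j)$.
   Context: Setting. Corridor with commuting locations $\mathcal I^*=\{1,\dots,i^*\}$ numbered outward from a single destination; a commuter from $i$ passes bottlenecks $i,i-1,\dots,1$. Capacities $\mu_1>\dots>\mu_{i^*}>0$, $\mu_{i^*+1}:=0$, $\bar\mu_i=\mu_i-\mu_{i+1}$; free-flow times $f_i\ge0$. $\mathcal H=[0,1]$ is the set of office work ratios $h$ (fraction of days commuting), $Q_i(h)\ge0$ is a given density of workers at $i$ with ratio $h$, with $X_i^*=\int_{\mathcal H}hQ_i(h)\,dh>0$. $\mathcal K=\{1,\dots,K\}$ indexes preferred arrival times $t_1<\dots<t_K$; $\mathcal T$ is a sufficiently long interval of destination arrival times $t$. Schedule delay cost $c_k(t)=c(t-t_k)$ with $c$ convex, piecewise differentiable, $c(0)=0$. Notation: $\widehat c(t)=\min_k c_k(t)$; $\widehat{\mathcal T}_k=\{t\in\mathcal T: c_k(t)=\widehat c(t)\}$; $\Gamma(c)=\{t\in\mathcal T:\widehat c(t)\le c\}$; $\bar c(X,\mu)$ is the value $c$ solving $\int_{\Gamma(c)}\mu\,dt=X$ (assumed uniquely defined for $X>0$). All pointwise-in-$t$ and pointwise-in-$h$ conditions are understood almost everywhere. $q_{i,k}(h,t)\ge0$ is the flow of workers of $i$ with ratio $h$, preferred time $t_k$, arriving at $t$. Short-term optimum $(q^{\mathrm{SO}},p^{\mathrm{SO}},\lambda^{\mathrm{SO}})$: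 optimal solution and Lagrange multipliers of: minimize $\sum_i\sum_k\int\int h\,c_k(t)q_{i,k}(h,t)\,dh\,dt$ over $q\ge0$ subject to $\sum_k\int_{\mathcal T}q_{i,k}(h,t)dt=Q_i(h)$ for all $i,h$ (multiplier $\lambda_i(h)$) and $\sum_{j\ge i}\sum_k\int_{\mathcal H}h\,q_{j,k}(h,t)dh\le\mu_i$ for all $i,t$ (multiplier $p_i(t)\ge0$). That is, besides these constraints, $p_i(t)>0$ implies equality in the capacity constraint, and $h\big(c_k(t)+\sum_{j\le i}p_j(t)\big)\ge\lambda_i(h)$ with equality if $q_{i,k}(h,t)>0$. Positivity/convexity assumption: for all $i\in\mathcal I^*$, $t\in\mathcal T$: $p_i^{\mathrm{SO}}(t)>0\iff\sum_k\int_{\mathcal H}q^{\mathrm{SO}}_{i,k}(h,t)dh>0$; and $\mathcal T_i^{\mathrm{SO}}:=\operatorname{supp}p_i^{\mathrm{SO}}$ (which is also the support of the flow from $i$) is convex. Short-term equilibrium: $(q,w,\lambda)$ with $q,w\ge0$, such that, with $\sigma_i(t)=t-\sum_{j<i}(w_j(t)+f_j)$ (departure time from bottleneck $i$ of commuters with destination arrival time $t$; a dot denotes $d/dt$): (1) $Q_i(h)=\sum_k\int_{\mathcal T}q_{i,k}(h,t)dt$ for all $i,h$; (2) $\sum_{j\ge i}\sum_k\int_{\mathcal H}h\,q_{j,k}(h,t)dh\le\mu_i\dot\sigma_i(t)$, with equality if $w_i(t)>0$; (3) $h\big(c_k(t)+\sum_{j\le i}w_j(t)\big)\ge\lambda_i(h)$,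 with equality if $q_{i,k}(h,t)>0$. $\mathcal T_i^{\mathrm{UE}}$ denotes the arrival time window of location $i$ in the equilibrium, i.e. the support of $w_i^{\mathrm{UE}}$. *)

theory Defs
  imports "HOL-Analysis.Analysis"
begin

section \<open>The corridor\<close>

text \<open>
  Locations are \<open>1, \<dots>, loc_count C\<close>, preferred arrival times are indexed by
  \<open>1, \<dots>, pref_count C\<close>, and the arrival times at the destination range over the compact
  interval \<open>arrivals C\<close>.  Functions indexed by locations or preferred times carry no meaning
  outside these index ranges, except that \<open>cap C (loc_count C + 1) = 0\<close> is required below.
\<close>

record corridor =
  loc_count :: nat
  cap :: "nat \<Rightarrow> real"
  free_flow :: "nat \<Rightarrow> real"
  workers :: "nat \<Rightarrow> real \<Rightarrow> real"
  pref_count :: nat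
  pref_time :: "nat \<Rightarrow> real"
  delay :: "real \<Rightarrow> real"
  t_first :: real
  t_last :: real

definition locs :: "corridor \<Rightarrow> nat set" where
  "locs C = {1..loc_count C}"

definition prefs :: "corridor \<Rightarrow> nat set" where
  "prefs C = {1..pref_count C}"

definition arrivals :: "corridor \<Rightarrow> real set" where
  "arrivals C = {t_first C..t_last C}"

definition ratio_measure :: "real measure" where
  "ratio_measure = restrict_space lborel {0..1}"

definition time_measure :: "corridor \<Rightarrow> real measure" where
  "time_measure C = restrict_space lborel (arrivals C)"

definition ratio_time_measure :: "corridor \<Rightarrow> (real \<times> real) measure" where
  "ratio_time_measure C = ratio_measure \<Otimes>\<^sub>M time_measure C"

definition sched_cost :: "corridor \<Rightarrow> nat \<Rightarrow> real \<Rightarrow> real" where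
  "sched_cost C k t = delay C (t - pref_time C k)"

definition min_cost :: "corridor \<Rightarrow> real \<Rightarrow> real" where
  "min_cost C t = Min ((\<lambda>k. sched_cost C k t) ` prefs C)"

definition best_times :: "corridor \<Rightarrow> nat \<Rightarrow> real set" where
  "best_times C k = {t \<in> arrivals C. sched_cost C k t = min_cost C t}"

definition cost_sublevel :: "corridor \<Rightarrow> real \<Rightarrow> real set" where
  "cost_sublevel C x = {t \<in> arrivals C. min_cost C t \<le> x}"

text \<open>
  The last conjunct says that the critical cost, i.e. the value \<open>x\<close> at which the service
  capacity \<open>\<integral> m dt\<close> over the sublevel set of \<open>min_cost\<close> equals the workload \<open>X\<close>, is uniquely
  defined.  The bound on \<open>X\<close> makes precise that the arrival interval is long enough for \<open>X\<close>:
  no such \<open>x\<close> exists, or it is not unique, once \<open>X\<close> reaches the capacity of the whole interval.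
\<close>

definition valid_corridor :: "corridor \<Rightarrow> bool" where
  "valid_corridor C \<longleftrightarrow>
     1 \<le> loc_count C \<and> 1 \<le> pref_count C \<and> t_first C < t_last C \<and>
     (\<forall>i\<in>locs C. cap C (i + 1) < cap C i) \<and> cap C (loc_count C + 1) = 0 \<and>
     (\<forall>i\<in>locs C. 0 \<le> free_flow C i) \<and>
     (\<forall>i\<in>locs C. (\<forall>h\<in>{0..1}. 0 \<le> workers C i h) \<and>
        integrable ratio_measure (workers C i) \<and>
        0 < (\<integral>h. h * workers C i h \<partial>ratio_measure)) \<and>
     strict_mono_on (prefs C) (pref_time C) \<and>
     convex_on UNIV (delay C) \<and>
     (\<forall>x y. delay C piecewise_differentiable_on {x..y}) \<and>
     delay C 0 = 0 \<and>
     (\<forall>m X. 0 < m \<and> 0 < X \<and> X < m * (t_last C - t_first C) \<longrightarrow>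
        (\<exists>!x. set_lebesgue_integral lborel (cost_sublevel C x) (\<lambda>_. m) = X))"


section \<open>Flows\<close>

text \<open>\<open>q i k h t\<close> is the flow of workers of location \<open>i\<close> with office work ratio \<open>h\<close> and
  preferred time \<open>k\<close> that arrive at \<open>t\<close>.\<close>

type_synonym flow = "nat \<Rightarrow> nat \<Rightarrow> real \<Rightarrow> real \<Rightarrow> real"

definition nonneg_flow :: "corridor \<Rightarrow> flow \<Rightarrow> bool" where
  "nonneg_flow C q \<longleftrightarrow> (\<forall>i\<in>locs C. \<forall>k\<in>prefs C.
     integrable (ratio_time_measure C) (\<lambda>(h, t). q i k h t) \<and>
     (AE (h, t) in ratio_time_measure C. 0 \<le> q i k h t))"

definition conserves_workers :: "corridor \<Rightarrow> flow \<Rightarrow> bool" where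
  "conserves_workers C q \<longleftrightarrow> (\<forall>i\<in>locs C. AE h in ratio_measure.
     (\<Sum>k\<in>prefs C. \<integral>t. q i k h t \<partial>time_measure C) = workers C i h)"

definition worker_flow :: "corridor \<Rightarrow> flow \<Rightarrow> nat \<Rightarrow> real \<Rightarrow> real" where
  "worker_flow C q i t = (\<Sum>k\<in>prefs C. \<integral>h. q i k h t \<partial>ratio_measure)"

definition commute_flow :: "corridor \<Rightarrow> flow \<Rightarrow> nat \<Rightarrow> nat \<Rightarrow> real \<Rightarrow> real" where
  "commute_flow C q i k t = (\<integral>h. h * q i k h t \<partial>ratio_measure)"

definition bottleneck_flow :: "corridor \<Rightarrow> flow \<Rightarrow> nat \<Rightarrow> real \<Rightarrow> real" where
  "bottleneck_flow C q i t = (\<Sum>j\<in>{i..loc_count C}. \<Sum>k\<in>prefs C. commute_flow C q j k t)"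

text \<open>\<open>r\<close> is either the family of queueing delays or the family of capacity multipliers.\<close>

definition cost_condition ::
    "corridor \<Rightarrow> flow \<Rightarrow> (nat \<Rightarrow> real \<Rightarrow> real) \<Rightarrow> (nat \<Rightarrow> real \<Rightarrow> real) \<Rightarrow> bool" where
  "cost_condition C q r lam \<longleftrightarrow> (\<forall>i\<in>locs C. \<forall>k\<in>prefs C. AE (h, t) in ratio_time_measure C.
     lam i h \<le> h * (sched_cost C k t + (\<Sum>j\<in>{1..i}. r j t)) \<and>
     (0 < q i k h t \<longrightarrow> h * (sched_cost C k t + (\<Sum>j\<in>{1..i}. r j t)) = lam i h))"

text \<open>The support of an almost everywhere defined function on the arrival interval (the
  essential support); for a continuous function it is the closure of its nonzero set.\<close>

definition arrival_window :: "corridor \<Rightarrow> (nat \<Rightarrow> real \<Rightarrow> real) \<Rightarrow> nat \<Rightarrow> real set" where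
  "arrival_window C r i = {t \<in> arrivals C. \<forall>e>0.
     0 < emeasure lborel {s \<in> arrivals C. dist s t < e \<and> r i s \<noteq> 0}}"


section \<open>Short-term optimum\<close>

definition so_feasible :: "corridor \<Rightarrow> flow \<Rightarrow> bool" where
  "so_feasible C q \<longleftrightarrow> nonneg_flow C q \<and> conserves_workers C q \<and>
     (\<forall>i\<in>locs C. AE t in time_measure C. bottleneck_flow C q i t \<le> cap C i)"

definition so_objective :: "corridor \<Rightarrow> flow \<Rightarrow> real" where
  "so_objective C q = (\<Sum>i\<in>locs C. \<Sum>k\<in>prefs C.
     \<integral>(h, t). h * sched_cost C k t * q i k h t \<partial>ratio_time_measure C)"

definition short_term_optimum ::
    "corridor \<Rightarrow> flow \<Rightarrow> (nat \<Rightarrow> real \<Rightarrow> real) \<Rightarrow> (nat \<Rightarrow> real \<Rightarrow> real) \<Rightarrow> bool" where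
  "short_term_optimum C q p lam \<longleftrightarrow>
     so_feasible C q \<and>
     (\<forall>q'. so_feasible C q' \<longrightarrow> so_objective C q \<le> so_objective C q') \<and>
     (\<forall>i\<in>locs C. p i \<in> borel_measurable (time_measure C)) \<and>
     (\<forall>i\<in>locs C. lam i \<in> borel_measurable ratio_measure) \<and>
     (\<forall>i\<in>locs C. AE t in time_measure C.
        0 \<le> p i t \<and> (0 < p i t \<longrightarrow> bottleneck_flow C q i t = cap C i)) \<and>
     cost_condition C q p lam"

definition positivity_convexity ::
    "corridor \<Rightarrow> flow \<Rightarrow> (nat \<Rightarrow> real \<Rightarrow> real) \<Rightarrow> bool" where
  "positivity_convexity C q p \<longleftrightarrow> (\<forall>i\<in>locs C.
     (AE t in time_measure C. 0 < p i t \<longleftrightarrow> 0 < worker_flow C q i t) \<and>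
     convex (arrival_window C p i))"


section \<open>Short-term equilibrium\<close>

definition departure_time ::
    "corridor \<Rightarrow> (nat \<Rightarrow> real \<Rightarrow> real) \<Rightarrow> nat \<Rightarrow> real \<Rightarrow> real" where
  "departure_time C w i t = t - (\<Sum>j\<in>{1..<i}. w j t + free_flow C j)"

definition abs_continuous_on :: "real set \<Rightarrow> (real \<Rightarrow> real) \<Rightarrow> bool" where
  "abs_continuous_on S g \<longleftrightarrow> (\<forall>e>0. \<exists>d>0. \<forall>D.
     D division_of \<Union>D \<and> \<Union>D \<subseteq> S \<and> (\<Sum>I\<in>D. measure lborel I) < d \<longrightarrow>
     (\<Sum>I\<in>D. \<bar>g (interval_upperbound I) - g (interval_lowerbound I)\<bar>) < e)"

text \<open>
  The queueing delays are absolutely continuous, so that the almost everywhere defined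
  derivatives of the departure times determine the departure times up to constants.
\<close>

definition short_term_equilibrium ::
    "corridor \<Rightarrow> flow \<Rightarrow> (nat \<Rightarrow> real \<Rightarrow> real) \<Rightarrow> (nat \<Rightarrow> real \<Rightarrow> real) \<Rightarrow> bool" where
  "short_term_equilibrium C q w lam \<longleftrightarrow>
     nonneg_flow C q \<and>
     (\<forall>i\<in>locs C. abs_continuous_on (arrivals C) (w i) \<and> (\<forall>t\<in>arrivals C. 0 \<le> w i t)) \<and>
     (\<forall>i\<in>locs C. lam i \<in> borel_measurable ratio_measure) \<and>
     conserves_workers C q \<and>
     (\<forall>i\<in>locs C. AE t in time_measure C.
        departure_time C w i differentiable (at t) \<and>
        bottleneck_flow C q i t \<le> cap C i * deriv (departure_time C w i) t \<and>
        (0 < w i t \<longrightarrow> bottleneck_flow C q i t = cap C i * deriv (departure_time C w i) t)) \<and>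
     cost_condition C q w lam"

text \<open>Multipliers are only determined almost everywhere, whereas departure times are to be
  differentiated; a continuous version is unique on the arrival interval.\<close>

definition continuous_version ::
    "corridor \<Rightarrow> (nat \<Rightarrow> real \<Rightarrow> real) \<Rightarrow> (nat \<Rightarrow> real \<Rightarrow> real) \<Rightarrow> bool" where
  "continuous_version C p w \<longleftrightarrow> (\<forall>i\<in>locs C.
     continuous_on (arrivals C) (w i) \<and> (AE t in time_measure C. w i t = p i t))"

definition equilibrium_flow ::
    "corridor \<Rightarrow> (nat \<Rightarrow> real \<Rightarrow> real) \<Rightarrow> flow \<Rightarrow> bool" where
  "equilibrium_flow C w q \<longleftrightarrow>
     nonneg_flow C q \<and>
     (\<forall>i\<in>locs C. \<forall>k\<in>prefs C. AE t in time_measure C.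
        commute_flow C q i k t =
          (if t \<in> arrival_window C w i \<inter> best_times C k
           then cap C i * deriv (departure_time C w i) t
                - cap C (i + 1) * deriv (departure_time C w (i + 1)) t
           else 0)) \<and>
     (\<forall>i\<in>locs C. \<forall>k\<in>prefs C. AE (h, t) in ratio_time_measure C.
        t \<notin> arrival_window C w i \<inter> best_times C k \<longrightarrow> q i k h t = 0) \<and>
     conserves_workers C q"

end

theory Submission
  imports Defs
begin

text \<open>
  Complementary slackness and conservation of workers give each location \<open>i\<close> a critical cost
  \<open>x i\<close> such that the total delay \<open>p 1 t + \<dots> + p i t\<close> is at least \<open>x i - min_cost C t\<close>, with
  equality where \<open>p i t > 0\<close>.  Since \<open>p i\<close> vanishes exactly where nobody from \<open>i\<close> arrives, \<open>x\<close>
  is strictly increasing and the total delay is the positive part of \<open>x i - min_cost C t\<close>.  This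
  is a Lipschitz function of \<open>t\<close>, and the arrival windows are, up to null sets, the nested
  sublevel sets \<open>min_cost C t < x i\<close>, so that the flows prescribed for the equilibrium telescope
  to the capacity at every congested bottleneck.
\<close>

section \<open>Preliminaries\<close>

text \<open>Multipliers and flows are given only almost everywhere, whereas the equilibrium asks for
  derivatives and for a division of the flow among preferred times. Two kinds of times stand in the
  way: those with \<open>min_cost C t = x i\<close>, where the positive part has a kink and
  membership in the closed window is unclear, and those at which two preferred times tie, where the
  prescribed flow would be counted twice. Both turn out to be null, because every workload below the
  total capacity has a critical cost and because \<open>delay C\<close> is convex.

  A second obstacle is that \<open>lam i h\<close> is tied to the critical cost only at ratios that
  have workers. Conservation closes this gap: a nonnegative flow vanishes almost everywhere at all
  other ratios, so the equality in the cost condition is never called upon there.\<close>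

lemma (in pair_sigma_finite) AE_pair_swap:
  assumes "AE z in M1 \<Otimes>\<^sub>M M2. P z"
  shows "AE y in M2. AE x in M1. P (x, y)"
proof -
  \<comment> \<open>\<open>AE_commute\<close> wants a measurable predicate, so the arbitrary
    \<open>P\<close> is replaced by avoidance of a measurable null set.\<close>
  obtain N where N: "N \<in> sets (M1 \<Otimes>\<^sub>M M2)" "emeasure (M1 \<Otimes>\<^sub>M M2) N = 0"
      "{z \<in> space (M1 \<Otimes>\<^sub>M M2). \<not> P z} \<subseteq> N"
    using assms unfolding eventually_ae_filter by auto
  have sets_N: "{z \<in> space (M1 \<Otimes>\<^sub>M M2). (fst z, snd z) \<notin> N} \<in> sets (M1 \<Otimes>\<^sub>M M2)"
    using N(1) by simp
  have "AE z in M1 \<Otimes>\<^sub>M M2. z \<notin> N"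
    using N(1,2) by (intro AE_not_in) (auto simp: null_sets_def)
  then have "AE x in M1. AE y in M2. (x, y) \<notin> N"
    by (rule AE_pair)
  then have "AE y in M2. AE x in M1. (x, y) \<notin> N"
    using AE_commute[of "\<lambda>x y. (x, y) \<notin> N", OF sets_N] by simp
  then show ?thesis
    using AE_space
  proof eventually_elim
    case (elim y)
    from elim(1) AE_space show ?case
      by eventually_elim (use elim(2) N(3) in \<open>auto simp: space_pair_measure\<close>)
  qed
qed

text \<open>Positive mass cannot sit inside a null set. No integrability is assumed; a
  non-integrable function has integral 0 by convention and so does not meet the first
  assumption.\<close>

lemma ex_pos_integrand:
  fixes f :: "'a \<Rightarrow> real"
  assumes "0 < integral\<^sup>L M f" "AE x in M. 0 < f x \<longrightarrow> P x"
  shows "\<exists>x. 0 < f x \<and> P x"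
proof (rule ccontr)
  assume "\<not> ?thesis"
  then have "AE x in M. 0 \<le> - f x"
    using assms(2) by (auto elim!: eventually_mono simp: not_less)
  then have "0 \<le> integral\<^sup>L M (\<lambda>x. - f x)"
    by (rule integral_nonneg_AE)
  then show False
    using assms(1) by simp
qed

section \<open>Lipschitz and convex functions of a real variable\<close>

lemma abs_continuous_on_lipschitz:
  fixes g :: "real \<Rightarrow> real"
  assumes "L-lipschitz_on S g"
  shows "abs_continuous_on S g"
  unfolding abs_continuous_on_def
proof (intro allI impI)
  fix e :: real assume "0 < e"
  have L: "0 \<le> L"
    using assms by (rule lipschitz_on_nonneg)
  show "\<exists>d>0. \<forall>D. D division_of \<Union>D \<and> \<Union>D \<subseteq> S \<and> (\<Sum>I\<in>D. measure lborel I) < d \<longrightarrow>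
     (\<Sum>I\<in>D. \<bar>g (interval_upperbound I) - g (interval_lowerbound I)\<bar>) < e"
  \<comment> \<open>The summand 1 keeps the quotient defined when \<open>L = 0\<close>.\<close>
  proof (intro exI[of _ "e / (L + 1)"] conjI allI impI)
    show "0 < e / (L + 1)"
      using \<open>0 < e\<close> L by simp
    fix D :: "real set set"
    assume D: "D division_of \<Union>D \<and> \<Union>D \<subseteq> S \<and> (\<Sum>I\<in>D. measure lborel I) < e / (L + 1)"
    have term_le: "\<bar>g (interval_upperbound I) - g (interval_lowerbound I)\<bar> \<le> L * measure lborel I"
      if I_in: "I \<in> D" for I
    proof -
      have div: "D division_of \<Union>D"
        using D by simp
      obtain a b where I: "I = cbox a b"
        using division_ofD(4)[OF div I_in] by blast
      have "I \<noteq> {}"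
        using division_ofD(3)[OF div I_in] .
      then have ab: "a \<le> b" "I = {a..b}"
        using I by auto
      have "a \<in> S" "b \<in> S"
        using ab I_in D by (metis UnionI atLeastAtMost_iff order_refl subsetD)+
      then show ?thesis
        using lipschitz_onD[OF assms, of b a] ab by (auto simp: dist_real_def)
    qed
    have "(\<Sum>I\<in>D. \<bar>g (interval_upperbound I) - g (interval_lowerbound I)\<bar>)
        \<le> L * (\<Sum>I\<in>D. measure lborel I)"
      unfolding sum_distrib_left by (rule sum_mono) (rule term_le)
    also have "\<dots> \<le> (L + 1) * (\<Sum>I\<in>D. measure lborel I)"
      by (intro mult_right_mono sum_nonneg) auto
    also have "\<dots> < e"
      using D L by (simp add: field_simps)
    finally show "(\<Sum>I\<in>D. \<bar>g (interval_upperbound I) - g (interval_lowerbound I)\<bar>) < e" .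
  qed
qed

lemma lipschitz_on_pos_part:
  fixes g :: "'a::metric_space \<Rightarrow> real"
  assumes "L-lipschitz_on S g"
  shows "L-lipschitz_on S (\<lambda>x. max 0 (g x))"
proof (rule lipschitz_onI)
  show "0 \<le> L"
    using assms by (rule lipschitz_on_nonneg)
  fix x y assume "x \<in> S" "y \<in> S"
  then have "dist (g x) (g y) \<le> L * dist x y"
    using assms by (rule lipschitz_onD[rotated])
  then show "dist (max 0 (g x)) (max 0 (g y)) \<le> L * dist x y"
    by (auto simp: dist_real_def max_def abs_if split: if_splits)
qed

lemma isCont_if_lipschitz_on_Icc:
  fixes f :: "real \<Rightarrow> real"
  assumes "\<And>a b. \<exists>L. L-lipschitz_on {a..b} f"
  shows "isCont f t"
proof -
  have "continuous_on {t - 1..t + 1} f"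
    using assms lipschitz_on_continuous_on by blast
  then show ?thesis
    by (rule continuous_on_interior) (simp add: interior_atLeastAtMost_real)
qed

text \<open>For \<open>b < c\<close> the chord over \<open>{b..c}\<close> is compared with both
  sides; for \<open>b = c\<close> that chord degenerates and the two given chords are
  adjacent.\<close>

lemma convex_slope_mono:
  fixes f :: "real \<Rightarrow> real"
  assumes f: "convex_on UNIV f" and "a < b" "b \<le> c" "c < d"
  shows "(f a - f b) / (a - b) \<le> (f c - f d) / (c - d)"
proof (cases "b = c")
  case True
  then show ?thesis
    using convex_on_slope_le[OF f, of a d b] assms by auto
next
  case False
  then show ?thesis
    using convex_on_slope_le[OF f, of a c b] convex_on_slope_le[OF f, of b d c] assms by auto
qed

text \<open>Every chord inside \<open>{a..b}\<close> has a slope between those of the chords over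
  \<open>{a - 1..a}\<close> and \<open>{b..b + 1}\<close>. These have length one, so their slopes
  are plain differences, and \<open>L\<close> adds up the absolute values.\<close>

lemma convex_lipschitz_on_Icc:
  fixes f :: "real \<Rightarrow> real"
  assumes f: "convex_on UNIV f"
  shows "\<exists>L. L-lipschitz_on {a..b} f"
proof -
  define L where "L = \<bar>f a - f (a - 1)\<bar> + \<bar>f (b + 1) - f b\<bar>"
  have "L-lipschitz_on {a..b} f"
  proof (rule lipschitz_on_leI)
    show "0 \<le> L"
      unfolding L_def by simp
    fix x y assume xy: "x \<in> {a..b}" "y \<in> {a..b}" "x \<le> y"
    show "dist (f x) (f y) \<le> L * dist x y"
    proof (cases "x = y")
      case False
      with xy have "x < y" by simp
      have "f a - f (a - 1) \<le> (f x - f y) / (x - y)" "(f x - f y) / (x - y) \<le> f (b + 1) - f b"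
        using convex_slope_mono[OF f, of "a - 1" a x y] convex_slope_mono[OF f, of x y b "b + 1"]
          xy \<open>x < y\<close> by auto
      then have "\<bar>(f x - f y) / (x - y)\<bar> \<le> L"
        unfolding L_def by linarith
      then show ?thesis
        using \<open>x < y\<close> by (simp add: dist_real_def abs_divide field_simps)
    qed simp
  qed
  then show ?thesis ..
qed

text \<open>Two horizontal chords of equal length force equal heights. If they overlap,
  \<open>x < y < x + d < y + d\<close>, then \<open>y\<close> lies under the first chord and
  \<open>x + d\<close> under the second, so \<open>f y \<le> f x = f (x + d) \<le> f y\<close>. If
  they do not, \<open>f\<close> cannot fall to the right of \<open>x + d\<close> nor rise to the
  left of \<open>y\<close>, so \<open>f (x + d) = f y\<close>. Applied to \<open>delay C\<close>,
  this handles times at which two preferred times cost the same.\<close>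

lemma convex_equal_shifts:
  fixes f :: "real \<Rightarrow> real"
  assumes f: "convex_on UNIV f" and ab: "a \<noteq> b"
    and s: "f (s - a) = f (s - b)" and t: "f (t - a) = f (t - b)"
  shows "f (s - a) = f (t - a)"
proof -
  have *: "f x = f y" if "x < x + d" "x < y" "f x = f (x + d)" "f y = f (y + d)" for x y d
  proof (cases "y < x + d")
    case True
    have "(f x - f y) / (x - y) \<le> 0" "0 \<le> (f (x + d) - f (y + d)) / (x + d - (y + d))"
      "(f y - f (x + d)) / (y - (x + d)) \<le> 0"
      using convex_on_slope_le[OF f, of x "x + d" y] convex_on_slope_le[OF f, of y "y + d" "x + d"]
        that True by auto
    then show ?thesis
      using convex_on_slope_le[OF f, of x "x + d" y] convex_on_slope_le[OF f, of y "y + d" "x + d"] that True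
      by (auto simp: divide_simps split: if_splits)
  next
    case False
    have "0 \<le> (f (x + d) - f y) / (x + d - y)" if "x + d < y"
      using convex_slope_mono[OF f, of x "x + d" "x + d" y] \<open>x < x + d\<close> \<open>f x = f (x + d)\<close> that by auto
    moreover have "(f (x + d) - f y) / (x + d - y) \<le> 0" if "x + d < y"
      using convex_slope_mono[OF f, of "x + d" y y "y + d"] \<open>x < x + d\<close> \<open>f y = f (y + d)\<close> that by auto
    ultimately have "f (x + d) = f y"
      using False by (cases "x + d = y") (auto simp: divide_simps split: if_splits)
    then show ?thesis
      using that by simp
  qed
  consider "s = t" | "s < t" "b < a" | "t < s" "b < a" | "s < t" "a < b" | "t < s" "a < b"
    using ab by linarith
  then show ?thesis
  proof cases
    case 2
    then show ?thesis using *[of "s - a" "a - b" "t - a"] s t by auto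
  next
    case 3
    then show ?thesis using *[of "t - a" "a - b" "s - a"] s t by auto
  next
    case 4
    then show ?thesis using *[of "s - b" "b - a" "t - b"] s t by auto
  next
    case 5
    then show ?thesis using *[of "t - b" "b - a" "s - b"] s t by auto
  qed simp
qed

lemma emeasure_Icc_Int_ball_pos:
  fixes a b t e :: real
  assumes "a < b" "t \<in> {a..b}" "0 < e"
  shows "0 < emeasure lborel {s \<in> {a..b}. dist s t < e}"
proof -
  \<comment> \<open>Since \<open>a < b\<close>, this interval is nondegenerate even when
    \<open>t\<close> is an endpoint; halving \<open>e\<close> keeps it inside the open ball.\<close>
  let ?l = "max a (t - e / 2)" and ?u = "min b (t + e / 2)"
  have lu: "?l < ?u"
    using assms by auto
  then have "0 < emeasure lborel {?l..?u}"
    unfolding emeasure_lborel_Icc[OF less_imp_le[OF lu]] by (simp only: ennreal_less_zero_iff diff_gt_0_iff_gt)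
  also have "\<dots> \<le> emeasure lborel {s \<in> {a..b}. dist s t < e}"
  proof (rule emeasure_mono)
    show "{?l..?u} \<subseteq> {s \<in> {a..b}. dist s t < e}"
      using assms(3) by (auto simp: dist_real_def)
    have "{s \<in> {a..b}. dist s t < e} = {a..b} \<inter> ball t e"
      by (auto simp: dist_commute)
    then show "{s \<in> {a..b}. dist s t < e} \<in> sets lborel"
      by simp
  qed
  finally show ?thesis .
qed

text \<open>Downward induction from the empty sum at \<open>Suc n\<close>. If \<open>i\<close> is
  open, so are all later indices, and the sum telescopes down to \<open>m (Suc n) = 0\<close>. If
  \<open>i\<close> is closed, then \<open>d i = d (Suc i) = 1\<close>, and the bound
  \<open>m (Suc i)\<close> passed on by the later indices is at most \<open>m i\<close>.\<close>

lemma telescoping_bottleneck_bound: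
  fixes m d :: "nat \<Rightarrow> real" and open_at :: "nat \<Rightarrow> bool"
  assumes "i \<le> Suc n" "1 \<le> i" "m (Suc n) = 0"
    and decreasing: "\<And>j. j \<in> {1..n} \<Longrightarrow> m (Suc j) \<le> m j"
    and upward: "\<And>j. j \<in> {1..<n} \<Longrightarrow> open_at j \<Longrightarrow> open_at (Suc j)"
    and undelayed: "\<And>j. j \<in> {1..n} \<Longrightarrow> \<not> open_at j \<Longrightarrow> d j = 1 \<and> d (Suc j) = 1"
  defines "S \<equiv> \<lambda>i. \<Sum>j\<in>{i..n}. if open_at j then m j * d j - m (Suc j) * d (Suc j) else 0"
  shows "S i \<le> m i * d i \<and> (i \<le> n \<longrightarrow> open_at i \<longrightarrow> S i = m i * d i)"
  using assms(1,2)
proof (induction i rule: inc_induct)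
  case base
  then show ?case
    using assms(3) by (simp add: S_def)
next
  case (step i)
  have S_Suc: "S i = (if open_at i then m i * d i - m (Suc i) * d (Suc i) else 0) + S (Suc i)"
    unfolding S_def using step by (subst sum.atLeast_Suc_atMost) auto
  show ?case
  proof (cases "open_at i")
    case True
    have "S (Suc i) = m (Suc i) * d (Suc i)"
    proof (cases "i = n")
      case True
      then show ?thesis
        using assms(3) by (simp add: S_def)
    next
      case False
      then show ?thesis
        using step upward[of i] True by auto
    qed
    then show ?thesis
      using S_Suc True by simp
  next
    case False
    then show ?thesis
      using S_Suc step undelayed[of i] decreasing[of i] by auto
  qed
qed

section \<open>The minimal schedule delay cost\<close>

locale valid_corridor_loc =
  fixes C :: corridor
  assumes valid: "valid_corridor C"
begin

lemma finite_prefs: "finite (prefs C)" and prefs_nonempty: "prefs C \<noteq> {}"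
  using valid by (auto simp: prefs_def valid_corridor_def)

lemma t_first_less_t_last: "t_first C < t_last C"
  using valid by (simp add: valid_corridor_def)

lemma delay_convex: "convex_on UNIV (delay C)"
  using valid by (simp add: valid_corridor_def)

lemma pref_time_inj: "k \<in> prefs C \<Longrightarrow> l \<in> prefs C \<Longrightarrow> k \<noteq> l \<Longrightarrow> pref_time C k \<noteq> pref_time C l"
  using valid strict_mono_on_imp_inj_on[of "prefs C" "pref_time C"]
  unfolding valid_corridor_def inj_on_def by metis

lemma space_time_measure: "space (time_measure C) = arrivals C"
  and sets_time_measure: "sets (time_measure C) = sets (restrict_space borel (arrivals C))"
  by (auto simp: time_measure_def space_restrict_space sets_restrict_space)

lemma space_ratio_measure: "space ratio_measure = {0..1}"
  by (simp add: ratio_measure_def space_restrict_space)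

lemma AE_time_measure:
  "(AE t in time_measure C. P t) \<longleftrightarrow> (AE t in lborel. t \<in> arrivals C \<longrightarrow> P t)"
  unfolding time_measure_def by (rule AE_restrict_space_iff) (simp add: arrivals_def)

text \<open>Permits division by the ratio in the cost conditions, which degenerate at
  \<open>h = 0\<close>.\<close>

lemma AE_ratio_pos: "AE h in ratio_measure. 0 < h"
proof -
  have "AE h in lborel. h \<noteq> (0::real)"
    by (rule AE_lborel_singleton)
  then show ?thesis
    unfolding ratio_measure_def
    by (subst AE_restrict_space_iff) (auto elim!: eventually_mono)
qed

sublocale pair_sigma_finite ratio_measure "time_measure C"
  unfolding pair_sigma_finite_def ratio_measure_def time_measure_def arrivals_def
  by (intro conjI sigma_finite_measure_restrict_space[OF sigma_finite_lborel]) auto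

lemma min_cost_le: "k \<in> prefs C \<Longrightarrow> min_cost C t \<le> sched_cost C k t"
  unfolding min_cost_def using finite_prefs by auto

lemma min_cost_attained: "\<exists>k\<in>prefs C. min_cost C t = sched_cost C k t"
  unfolding min_cost_def using finite_prefs prefs_nonempty
  by (metis (no_types, lifting) Min_in finite_imageI image_iff image_is_empty)

lemma sched_cost_lipschitz: "\<exists>L. L-lipschitz_on {a..b} (sched_cost C k)"
proof -
  obtain L where L: "L-lipschitz_on {a - pref_time C k..b - pref_time C k} (delay C)"
    using convex_lipschitz_on_Icc[OF delay_convex] by blast
  have "L-lipschitz_on {a..b} (sched_cost C k)"
  proof (rule lipschitz_onI)
    fix x y assume "x \<in> {a..b}" "y \<in> {a..b}"
    then show "dist (sched_cost C k x) (sched_cost C k y) \<le> L * dist x y"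
      using lipschitz_onD[OF L, of "x - pref_time C k" "y - pref_time C k"]
      by (simp add: sched_cost_def dist_real_def)
  qed (rule lipschitz_on_nonneg[OF L])
  then show ?thesis ..
qed

text \<open>A minimiser at \<open>x\<close> is a competitor at \<open>y\<close>, and conversely. The
  sum of the individual constants serves as a common Lipschitz constant.\<close>

lemma min_cost_lipschitz: "\<exists>L. L-lipschitz_on {a..b} (min_cost C)"
proof -
  obtain L :: "nat \<Rightarrow> real" where L: "\<And>k. (L k)-lipschitz_on {a..b} (sched_cost C k)"
    using sched_cost_lipschitz by metis
  have L_nonneg: "0 \<le> L k" for k
    using L by (rule lipschitz_on_nonneg)
  have L_le: "L k \<le> sum L (prefs C)" if "k \<in> prefs C" for k
    using that finite_prefs L_nonneg by (auto intro: member_le_sum)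
  have upper: "min_cost C y \<le> min_cost C x + sum L (prefs C) * dist x y"
    if xy: "x \<in> {a..b}" "y \<in> {a..b}" for x y
  proof -
    obtain k where k: "k \<in> prefs C" "min_cost C x = sched_cost C k x"
      using min_cost_attained by blast
    have "sched_cost C k y \<le> sched_cost C k x + L k * dist x y"
      using lipschitz_onD[OF L xy, of k] by (auto simp: dist_real_def)
    also have "\<dots> \<le> sched_cost C k x + sum L (prefs C) * dist x y"
      using L_le[OF k(1)] by (intro add_left_mono mult_right_mono) auto
    finally show ?thesis
      using min_cost_le[OF k(1), of y] k(2) by simp
  qed
  have "(sum L (prefs C))-lipschitz_on {a..b} (min_cost C)"
  proof (rule lipschitz_onI)
    show "0 \<le> sum L (prefs C)"
      using L_nonneg by (rule sum_nonneg)
    fix x y assume "x \<in> {a..b}" "y \<in> {a..b}"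
    then show "dist (min_cost C x) (min_cost C y) \<le> sum L (prefs C) * dist x y"
      using upper[of x y] upper[of y x] by (auto simp: dist_real_def abs_minus_commute)
  qed
  then show ?thesis ..
qed

lemma min_cost_isCont: "isCont (min_cost C) t"
  using min_cost_lipschitz by (rule isCont_if_lipschitz_on_Icc)

lemma sched_cost_isCont: "isCont (sched_cost C k) t"
  using sched_cost_lipschitz by (rule isCont_if_lipschitz_on_Icc)

lemma min_cost_borel [measurable]: "min_cost C \<in> borel_measurable borel"
  by (intro borel_measurable_continuous_onI continuous_at_imp_continuous_on ballI min_cost_isCont)

text \<open>A level set of positive measure would be a jump of the capacity of the sublevel sets,
  so that some workload in between would have no critical cost.\<close>

lemma min_cost_level_null: "{t \<in> arrivals C. min_cost C t = x} \<in> null_sets lborel"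
proof -
  let ?F = "\<lambda>x. measure lborel (cost_sublevel C x)"
  let ?A = "{t \<in> arrivals C. min_cost C t = x}"
  have sublevel: "cost_sublevel C y \<in> sets lborel" for y
    unfolding cost_sublevel_def arrivals_def by measurable
  have level: "?A \<in> sets lborel"
    unfolding arrivals_def by measurable
  have arrivals_fm: "arrivals C \<in> fmeasurable lborel"
    unfolding arrivals_def by (simp add: fmeasurable_def emeasure_lborel_Icc_eq)
  have fm: "A \<in> fmeasurable lborel" if "A \<in> sets lborel" "A \<subseteq> arrivals C" for A
    using arrivals_fm that(2,1) by (rule fmeasurableI2)
  have F_le: "?F y \<le> measure lborel (arrivals C)" for y
    using sublevel arrivals_fm by (intro measure_mono_fmeasurable) (auto simp: cost_sublevel_def)
  have arrivals_measure: "measure lborel (arrivals C) = t_last C - t_first C"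
    using t_first_less_t_last by (simp add: arrivals_def)
  have "measure lborel ?A = 0"
  proof (rule ccontr)
    assume "measure lborel ?A \<noteq> 0"
    then have pos: "0 < measure lborel ?A"
      by (simp add: zero_less_measure_iff)
    \<comment> \<open>The middle of the jump at \<open>x\<close>: sublevel sets below
      \<open>x\<close> have measure at most \<open>?F x - measure lborel ?A\<close>, all others at
      least \<open>?F x\<close>. With capacity \<open>m = 1\<close> the workload of a sublevel set
      is its measure, so \<open>v\<close> would be a workload without critical cost.\<close>
    define v where "v = ?F x - measure lborel ?A / 2"
    have A_le: "measure lborel ?A \<le> ?F x"
      using level sublevel by (intro measure_mono_fmeasurable fm) (auto simp: cost_sublevel_def)
    have "0 < v" "v < t_last C - t_first C"
      using pos A_le F_le[of x] arrivals_measure unfolding v_def by linarith+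
    then have "\<exists>y. set_lebesgue_integral lborel (cost_sublevel C y) (\<lambda>_. 1) = v"
      using valid unfolding valid_corridor_def by (metis mult_1 zero_less_one)
    then obtain y where y: "?F y = v"
      using sublevel by (auto simp: set_lebesgue_integral_def)
    show False
    proof (cases "y < x")
      case True
      have "?F y + measure lborel ?A = measure lborel (cost_sublevel C y \<union> ?A)"
        using sublevel level True
        by (intro measure_Un_AE[symmetric] fm AE_I2) (auto simp: cost_sublevel_def)
      also have "\<dots> \<le> ?F x"
        using sublevel level True
        by (intro measure_mono_fmeasurable fm) (auto simp: cost_sublevel_def)
      finally show False
        using y pos unfolding v_def by simp
    next
      case False
      then have "?F x \<le> ?F y"
        using sublevel by (intro measure_mono_fmeasurable fm) (auto simp: cost_sublevel_def)
      then show False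
        using y pos unfolding v_def by simp
    qed
  qed
  then show ?thesis
    using fm[OF level] level by (auto simp: emeasure_eq_measure2 null_sets_def)
qed

lemma AE_min_cost_neq: "AE t in time_measure C. min_cost C t \<noteq> x"
  unfolding AE_time_measure
  using AE_not_in[OF min_cost_level_null[of x]] by (auto elim!: eventually_mono)

lemma AE_interior_arrivals: "AE t in time_measure C. t \<in> {t_first C<..<t_last C}"
  unfolding AE_time_measure
  using AE_lborel_singleton[of "t_first C"] AE_lborel_singleton[of "t_last C"]
  by eventually_elim (auto simp: arrivals_def)

text \<open>By convexity \<open>min_cost\<close> is constant on the set where two given preferred times are both
  best, which is therefore contained in a level set.\<close>

lemma AE_best_times_unique:
  "AE t in time_measure C. \<forall>k\<in>prefs C. \<forall>l\<in>prefs C. t \<in> best_times C k \<inter> best_times C l \<longrightarrow> k = l"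
proof (intro AE_finite_allI finite_prefs)
  fix k l :: nat assume k: "k \<in> prefs C" and l: "l \<in> prefs C"
  show "AE t in time_measure C. t \<in> best_times C k \<inter> best_times C l \<longrightarrow> k = l"
  proof (cases "k = l \<or> best_times C k \<inter> best_times C l = {}")
    case False
    then obtain s where s: "s \<in> best_times C k \<inter> best_times C l" by blast
    have const: "min_cost C t = min_cost C s" if "t \<in> best_times C k \<inter> best_times C l" for t
      using convex_equal_shifts[OF delay_convex pref_time_inj[OF k l], of t s] s that False
      by (auto simp: best_times_def sched_cost_def)
    show ?thesis
      by (rule eventually_mono[OF AE_min_cost_neq[of "min_cost C s"]]) (use const in blast)
  next
    case True
    then have "t \<in> best_times C k \<inter> best_times C l \<longrightarrow> k = l" for t
      by blast
    then show ?thesis by simp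
  qed
qed

section \<open>Almost everywhere differentiability of the minimal cost\<close>

lemma AE_sched_cost_differentiable:
  fixes k :: nat
  shows "AE t in time_measure C. sched_cost C k differentiable (at t)"
proof -
  \<comment> \<open>The margin of 1 on either side puts all shifted arrival times into the interior,
    where the derivative within the interval is the two-sided one.\<close>
  let ?a = "t_first C - pref_time C k - 1" and ?b = "t_last C - pref_time C k + 1"
  have "delay C piecewise_differentiable_on {?a..?b}"
    using valid by (simp add: valid_corridor_def)
  then obtain S where S: "finite S"
      "\<And>x. x \<in> {?a..?b} - S \<Longrightarrow> delay C differentiable (at x within {?a..?b})"
    unfolding piecewise_differentiable_on_def by blast
  let ?N = "(\<lambda>x. x + pref_time C k) ` S"
  have "AE t in lborel. t \<notin> ?N"
    using S(1) by (intro AE_not_in finite_imp_null_set_lborel) auto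
  then show ?thesis
    unfolding AE_time_measure
  proof (rule AE_mp, intro AE_I2 impI)
    fix t assume t: "t \<notin> ?N" "t \<in> arrivals C"
    have not_S: "t - pref_time C k \<notin> S"
      using t(1) by (metis diff_add_cancel image_eqI)
    have inner: "t - pref_time C k \<in> interior {?a..?b}"
      using t(2) by (simp add: interior_atLeastAtMost_real arrivals_def)
    then have "delay C differentiable (at (t - pref_time C k))"
      using S(2)[of "t - pref_time C k"] not_S interior_subset
      by (metis DiffI at_within_interior subsetD)
    then obtain D where "(delay C has_real_derivative D) (at (t - pref_time C k))"
      using real_differentiable_def by blast
    then have "((\<lambda>s. delay C (s - pref_time C k)) has_real_derivative D) (at t)"
      using DERIV_shift[of "delay C" D t "- pref_time C k"] by simp
    then show "sched_cost C k differentiable (at t)"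
      unfolding sched_cost_def[abs_def] real_differentiable_def by blast
  qed
qed

text \<open>Away from ties the best preferred time is unique and, by continuity, remains strictly
  best nearby, so \<open>min_cost C\<close> agrees locally with a single schedule cost.\<close>

lemma AE_min_cost_differentiable: "AE t in time_measure C. min_cost C differentiable (at t)"
proof -
  have "AE t in time_measure C. \<forall>k\<in>prefs C. sched_cost C k differentiable (at t)"
    by (intro AE_finite_allI finite_prefs AE_sched_cost_differentiable)
  with AE_best_times_unique show ?thesis
    using AE_space
  proof eventually_elim
    case (elim t)
    then have t: "t \<in> arrivals C"
      by (simp add: space_time_measure)
    obtain k where k: "k \<in> prefs C" "min_cost C t = sched_cost C k t"
      using min_cost_attained by blast
    have less: "sched_cost C k t < sched_cost C l t" if "l \<in> prefs C - {k}" for l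
    proof -
      have "t \<notin> best_times C l"
        using elim(1) k t that by (auto simp: best_times_def)
      then show ?thesis
        using min_cost_le[of l t] k t that by (auto simp: best_times_def)
    qed
    have "eventually (\<lambda>s. \<forall>l\<in>prefs C - {k}. sched_cost C k s < sched_cost C l s) (nhds t)"
    proof (intro eventually_ball_finite ballI)
      fix l assume "l \<in> prefs C - {k}"
      then show "eventually (\<lambda>s. sched_cost C k s < sched_cost C l s) (nhds t)"
        unfolding eventually_nhds using less open_Collect_less[of "sched_cost C k" "sched_cost C l"]
          sched_cost_isCont by (intro exI[of _ "{s. sched_cost C k s < sched_cost C l s}"])
          (auto intro: continuous_at_imp_continuous_on)
    qed (use finite_prefs in auto)
    then have ev: "eventually (\<lambda>s. min_cost C s = sched_cost C k s) (nhds t)"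
    proof eventually_elim
      case (elim s)
      obtain l where l: "l \<in> prefs C" "min_cost C s = sched_cost C l s"
        using min_cost_attained by blast
      then show ?case
        using bspec[OF elim, of l] min_cost_le[OF k(1), of s] by (cases "l = k") auto
    qed
    obtain D where "(sched_cost C k has_real_derivative D) (at t)"
      using elim(2) k(1) real_differentiable_def by blast
    then have "(min_cost C has_real_derivative D) (at t)"
      unfolding DERIV_cong_ev[OF refl ev refl] .
    then show ?case
      using real_differentiable_def by blast
  qed
qed

section \<open>Critical costs of the short-term optimum\<close>

lemma workers_nonneg: "i \<in> locs C \<Longrightarrow> h \<in> {0..1} \<Longrightarrow> 0 \<le> workers C i h"
  and workers_integrable: "i \<in> locs C \<Longrightarrow> integrable ratio_measure (workers C i)"
  and workload_pos: "i \<in> locs C \<Longrightarrow> 0 < (\<integral>h. h * workers C i h \<partial>ratio_measure)"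
  using valid unfolding valid_corridor_def by blast+

text \<open>Ratios are at most one, so the number of workers dominates the workload.\<close>

lemma workers_integral_pos:
  assumes i: "i \<in> locs C"
  shows "0 < integral\<^sup>L ratio_measure (workers C i)"
proof -
  have "(\<integral>h. h * workers C i h \<partial>ratio_measure) \<le> integral\<^sup>L ratio_measure (workers C i)"
    using workers_nonneg[OF i] workers_integrable[OF i]
    by (intro integral_mono') (auto simp: space_ratio_measure mult_left_le_one_le)
  with workload_pos[OF i] show ?thesis by simp
qed

context
  fixes q :: flow and i :: nat
  assumes nonneg: "nonneg_flow C q" and conserves: "conserves_workers C q" and i: "i \<in> locs C"
begin

lemma flow_integrable:
  "k \<in> prefs C \<Longrightarrow> integrable (ratio_measure \<Otimes>\<^sub>M time_measure C) (\<lambda>(h, t). q i k h t)"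
  and flow_nonneg: "k \<in> prefs C \<Longrightarrow> AE (h, t) in ratio_measure \<Otimes>\<^sub>M time_measure C. 0 \<le> q i k h t"
  using nonneg i unfolding nonneg_flow_def ratio_time_measure_def by blast+

lemma AE_workers_eq:
  "AE h in ratio_measure. (\<Sum>k\<in>prefs C. \<integral>t. q i k h t \<partial>time_measure C) = workers C i h"
  using conserves i unfolding conserves_workers_def by blast

text \<open>Conservation is stated ratio by ratio, the positivity assumption time by time; Fubini
  carries the positive number of workers from one to the other.\<close>

lemma worker_flow_integral:
  "integral\<^sup>L (time_measure C) (worker_flow C q i) = integral\<^sup>L ratio_measure (workers C i)"
proof -
  have "integral\<^sup>L (time_measure C) (worker_flow C q i)
      = (\<Sum>k\<in>prefs C. \<integral>t. \<integral>h. q i k h t \<partial>ratio_measure \<partial>time_measure C)"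
    unfolding worker_flow_def using integrable_snd[OF flow_integrable] by (intro Bochner_Integration.integral_sum)
  also have "\<dots> = (\<Sum>k\<in>prefs C. \<integral>h. \<integral>t. q i k h t \<partial>time_measure C \<partial>ratio_measure)"
    using integral_fst[OF flow_integrable] integral_snd[OF flow_integrable] by (intro sum.cong) auto
  also have "\<dots> = (\<integral>h. (\<Sum>k\<in>prefs C. \<integral>t. q i k h t \<partial>time_measure C) \<partial>ratio_measure)"
    using integrable_fst[OF flow_integrable] by (intro Bochner_Integration.integral_sum[symmetric])
  also have "\<dots> = integral\<^sup>L ratio_measure (workers C i)"
    using integrable_fst[OF flow_integrable] workers_integrable[OF i] AE_workers_eq
    by (intro integral_cong_AE) auto
  finally show ?thesis .
qed

text \<open>At a ratio without workers the nonnegative flows integrate to zero over time, hence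
  vanish almost everywhere, and the claim is vacuous. The lemma serves the optimal flow as well as
  the equilibrium flow.\<close>

lemma AE_flow_pos_ratio:
  assumes lam: "lam \<in> borel_measurable ratio_measure" and k: "k \<in> prefs C"
    and lam_eq: "AE h in ratio_measure. 0 < workers C i h \<longrightarrow> lam h = h * x"
  shows "AE (h, t) in ratio_measure \<Otimes>\<^sub>M time_measure C. 0 < q i k h t \<longrightarrow> lam h = h * x"
proof (rule AE_pair_measure)
  have [measurable]: "(\<lambda>(h, t). q i k h t) \<in> borel_measurable (ratio_measure \<Otimes>\<^sub>M time_measure C)"
    using flow_integrable[OF k] by (rule borel_measurable_integrable)
  have [measurable]: "(\<lambda>h. h) \<in> borel_measurable ratio_measure"
    unfolding ratio_measure_def by (intro measurable_restrict_space1) simp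
  note lam [measurable]
  have "{z \<in> space (ratio_measure \<Otimes>\<^sub>M time_measure C).
      0 < (\<lambda>(h, t). q i k h t) z \<longrightarrow> lam (fst z) = fst z * x} \<in> sets (ratio_measure \<Otimes>\<^sub>M time_measure C)"
    by measurable
  then show "{z \<in> space (ratio_measure \<Otimes>\<^sub>M time_measure C).
      case z of (h, t) \<Rightarrow> 0 < q i k h t \<longrightarrow> lam h = h * x} \<in> sets (ratio_measure \<Otimes>\<^sub>M time_measure C)"
    by (simp add: case_prod_unfold)
  have "AE h in ratio_measure. \<forall>k\<in>prefs C. AE t in time_measure C. 0 \<le> q i k h t"
    using AE_pair[OF flow_nonneg] by (intro AE_finite_allI finite_prefs) simp
  moreover have "AE h in ratio_measure. integrable (time_measure C) (q i k h)"
    using AE_integrable_fst[OF flow_integrable[OF k]] .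
  ultimately have "AE h in ratio_measure. AE t in time_measure C. 0 < q i k h t \<longrightarrow> lam h = h * x"
    using AE_workers_eq lam_eq AE_space
  proof eventually_elim
    case (elim h)
    show ?case
    proof (cases "0 < workers C i h")
      case False
      then have "(\<Sum>k\<in>prefs C. \<integral>t. q i k h t \<partial>time_measure C) = 0"
        using elim(3,5) workers_nonneg[OF i, of h] by (simp add: space_ratio_measure)
      then have "integral\<^sup>L (time_measure C) (q i k h) = 0"
        using finite_prefs k elim(1) by (subst (asm) sum_nonneg_eq_0_iff) (auto intro: integral_nonneg_AE)
      then have "AE t in time_measure C. q i k h t = 0"
        using integral_nonneg_eq_0_iff_AE elim(1,2) k by blast
      then show ?thesis
        by eventually_elim simp
    qed (use elim(4) in simp)
  qed
  then show "AE h in ratio_measure. AE t in time_measure C.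
      case (h, t) of (h, t) \<Rightarrow> 0 < q i k h t \<longrightarrow> lam h = h * x"
    by simp
qed

text \<open>A ratio with workers puts positive mass on some preferred time, so any property that
  holds almost everywhere on its flow has an actual witness.\<close>

lemma ex_flow_pos:
  assumes "0 < workers C i h" "(\<Sum>k\<in>prefs C. \<integral>t. q i k h t \<partial>time_measure C) = workers C i h"
    and "\<And>k. k \<in> prefs C \<Longrightarrow> AE t in time_measure C. 0 < q i k h t \<longrightarrow> P k t"
  shows "\<exists>k\<in>prefs C. \<exists>t. P k t"
proof -
  have "\<exists>k\<in>prefs C. 0 < (\<integral>t. q i k h t \<partial>time_measure C)"
    using assms(1,2) sum_nonpos[of "prefs C" "\<lambda>k. \<integral>t. q i k h t \<partial>time_measure C"] by (force simp: not_less)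
  then show ?thesis
    using ex_pos_integrand assms(3) by blast
qed

end

text \<open>A ratio with workers attains its multiplier at some arrival time, so the quotients of
  multiplier and ratio coincide for all such ratios; their common value is the critical cost.\<close>

lemma critical_cost:
  assumes opt: "short_term_optimum C q p lam" and pos: "positivity_convexity C q p"
    and i: "i \<in> locs C"
  shows "\<exists>x. (AE h in ratio_measure. 0 < workers C i h \<longrightarrow> lam i h = h * x) \<and>
     (AE t in time_measure C. x \<le> min_cost C t + (\<Sum>j\<in>{1..i}. p j t)) \<and>
     (AE t in time_measure C. 0 < p i t \<longrightarrow> min_cost C t + (\<Sum>j\<in>{1..i}. p j t) = x)"
proof -
  let ?P = "\<lambda>t. \<Sum>j\<in>{1..i}. p j t"
  have q: "nonneg_flow C q" "conserves_workers C q"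
    using opt by (auto simp: short_term_optimum_def so_feasible_def)
  have cost: "AE (h, t) in ratio_measure \<Otimes>\<^sub>M time_measure C. lam i h \<le> h * (sched_cost C k t + ?P t) \<and>
     (0 < q i k h t \<longrightarrow> h * (sched_cost C k t + ?P t) = lam i h)" if "k \<in> prefs C" for k
    using opt i that unfolding short_term_optimum_def cost_condition_def ratio_time_measure_def by blast
  \<comment> \<open>A ratio is good if the conditions on ratio and time, restricted to it, hold for
    almost every time; this allows single ratios to be compared.\<close>
  define good where "good h \<longleftrightarrow> 0 < h \<and>
    (\<forall>k\<in>prefs C. AE t in time_measure C. lam i h \<le> h * (sched_cost C k t + ?P t) \<and>
       (0 < q i k h t \<longrightarrow> h * (sched_cost C k t + ?P t) = lam i h)) \<and>
    (\<Sum>k\<in>prefs C. \<integral>t. q i k h t \<partial>time_measure C) = workers C i h" for h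
  have "AE h in ratio_measure. \<forall>k\<in>prefs C. AE t in time_measure C.
      lam i h \<le> h * (sched_cost C k t + ?P t) \<and>
      (0 < q i k h t \<longrightarrow> h * (sched_cost C k t + ?P t) = lam i h)"
    using AE_pair[OF cost] by (intro AE_finite_allI finite_prefs) simp
  then have AE_good: "AE h in ratio_measure. good h"
    using AE_ratio_pos AE_workers_eq[OF q i] unfolding good_def by eventually_elim blast
  \<comment> \<open>At a time used by \<open>h\<close>, the full cost \<open>y\<close> per trip
    equals \<open>lam i h / h\<close>, while the inequality for \<open>h'\<close> at the same time
    gives \<open>lam i h' / h' \<le> y\<close>.\<close>
  have quot_le: "lam i h' / h' \<le> lam i h / h" if h: "good h" "0 < workers C i h" and h': "good h'" for h h'
  proof -
    have "\<exists>k\<in>prefs C. \<exists>t. h * (sched_cost C k t + ?P t) = lam i h \<and>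
        lam i h' \<le> h' * (sched_cost C k t + ?P t)"
    proof (rule ex_flow_pos[OF q i h(2)])
      fix k assume k: "k \<in> prefs C"
      have "AE t in time_measure C. lam i h \<le> h * (sched_cost C k t + ?P t) \<and>
          (0 < q i k h t \<longrightarrow> h * (sched_cost C k t + ?P t) = lam i h)"
        "AE t in time_measure C. lam i h' \<le> h' * (sched_cost C k t + ?P t) \<and>
          (0 < q i k h' t \<longrightarrow> h' * (sched_cost C k t + ?P t) = lam i h')"
        using h(1) h' k unfolding good_def by blast+
      then show "AE t in time_measure C. 0 < q i k h t \<longrightarrow> h * (sched_cost C k t + ?P t) = lam i h \<and>
        lam i h' \<le> h' * (sched_cost C k t + ?P t)"
        by eventually_elim blast
    qed (use h(1) in \<open>simp add: good_def\<close>)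
    then obtain y where "h * y = lam i h" "lam i h' \<le> h' * y"
      by blast
    moreover have "0 < h" "0 < h'"
      using h(1) h' by (auto simp: good_def)
    ultimately have "lam i h / h = y" "lam i h' / h' \<le> y"
      by (auto simp: field_simps)
    then show ?thesis by simp
  qed
  have "\<exists>h. 0 < workers C i h \<and> good h"
    by (rule ex_pos_integrand[OF workers_integral_pos[OF i]]) (use AE_good in \<open>eventually_elim, simp\<close>)
  then obtain h0 where h0: "0 < workers C i h0" "good h0"
    by blast
  define x where "x = lam i h0 / h0"
  have h0_pos: "0 < h0"
    using h0(2) by (simp add: good_def)
  have lam_eq: "AE h in ratio_measure. 0 < workers C i h \<longrightarrow> lam i h = h * x"
    using AE_good
  proof eventually_elim
    case (elim h)
    have "0 < h"
      using elim by (simp add: good_def)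
    then show ?case
      using quot_le[of h h0] quot_le[of h0 h] elim h0 by (auto simp: x_def field_simps)
  qed
  have "AE t in time_measure C. \<forall>k\<in>prefs C. x \<le> sched_cost C k t + ?P t"
  proof (intro AE_finite_allI finite_prefs)
    fix k assume "k \<in> prefs C"
    then have "AE t in time_measure C. lam i h0 \<le> h0 * (sched_cost C k t + ?P t) \<and>
        (0 < q i k h0 t \<longrightarrow> h0 * (sched_cost C k t + ?P t) = lam i h0)"
      using h0(2) unfolding good_def by blast
    then show "AE t in time_measure C. x \<le> sched_cost C k t + ?P t"
      by eventually_elim (use h0_pos in \<open>auto simp: x_def field_simps\<close>)
  qed
  then have lower: "AE t in time_measure C. x \<le> min_cost C t + ?P t"
    by eventually_elim (metis min_cost_attained)
  \<comment> \<open>The time is now quantified first, since \<open>p i t > 0\<close> is a statement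
    about a fixed time. Replacing \<open>lam i h\<close> by \<open>h * x\<close> and dividing by
    \<open>h\<close> removes the ratio.\<close>
  have active: "AE t in time_measure C. \<forall>k\<in>prefs C. AE h in ratio_measure.
      0 < q i k h t \<longrightarrow> sched_cost C k t + ?P t = x"
  proof (intro AE_finite_allI finite_prefs)
    fix k assume k: "k \<in> prefs C"
    have "lam i \<in> borel_measurable ratio_measure"
      using opt i by (simp add: short_term_optimum_def)
    from AE_pair_swap[OF AE_flow_pos_ratio[OF q i this k lam_eq]] AE_pair_swap[OF cost[OF k]]
    show "AE t in time_measure C. AE h in ratio_measure. 0 < q i k h t \<longrightarrow> sched_cost C k t + ?P t = x"
    proof eventually_elim
      case (elim t)
      from elim AE_ratio_pos show ?case
        by eventually_elim auto
    qed
  qed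
  have "AE t in time_measure C. 0 < p i t \<longleftrightarrow> 0 < worker_flow C q i t"
    using pos i by (simp add: positivity_convexity_def)
  with lower active have "AE t in time_measure C. 0 < p i t \<longrightarrow> min_cost C t + ?P t = x"
  proof eventually_elim
    case (elim t)
    show ?case
    proof
      assume "0 < p i t"
      then have "0 < (\<Sum>k\<in>prefs C. \<integral>h. q i k h t \<partial>ratio_measure)"
        using elim(3) by (simp add: worker_flow_def)
      then obtain k where k: "k \<in> prefs C" "0 < (\<integral>h. q i k h t \<partial>ratio_measure)"
        using sum_nonpos[of "prefs C" "\<lambda>k. \<integral>h. q i k h t \<partial>ratio_measure"] by (force simp: not_less)
      have "\<exists>h. 0 < q i k h t \<and> sched_cost C k t + ?P t = x"
        using ex_pos_integrand[OF k(2)] bspec[OF elim(2) k(1)] .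
      then have "sched_cost C k t + ?P t = x"
        by blast
      \<comment> \<open>A preferred time used at \<open>t\<close> is a best one: its cost attains
        the lower bound \<open>x\<close>, which already holds for
        \<open>min_cost C t\<close>.\<close>
      then show "min_cost C t + ?P t = x"
        using min_cost_le[OF k(1), of t] elim(1) by simp
    qed
  qed
  with lam_eq lower show ?thesis by blast
qed

text \<open>Turns an almost everywhere statement conditional on \<open>0 < p i t\<close> into an
  unconditional one when its conclusion does not depend on \<open>t\<close>.\<close>

lemma ex_multiplier_pos:
  assumes opt: "short_term_optimum C q p lam" and pos: "positivity_convexity C q p"
    and i: "i \<in> locs C" and P: "AE t in time_measure C. P t"
  shows "\<exists>t. 0 < p i t \<and> P t"
proof -
  have q: "nonneg_flow C q" "conserves_workers C q"
    using opt by (auto simp: short_term_optimum_def so_feasible_def)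
  have "AE t in time_measure C. 0 < p i t \<longleftrightarrow> 0 < worker_flow C q i t"
    using pos i by (simp add: positivity_convexity_def)
  then have "AE t in time_measure C. 0 < worker_flow C q i t \<longrightarrow> 0 < p i t \<and> P t"
    using P by eventually_elim blast
  then have "\<exists>t. 0 < worker_flow C q i t \<and> 0 < p i t \<and> P t"
    using worker_flow_integral[OF q i] workers_integral_pos[OF i] by (intro ex_pos_integrand) simp_all
  then show ?thesis by blast
qed

text \<open>Index 0 stands for the empty sum of delays; \<open>x 0\<close> has no meaning.\<close>

definition total_delay :: "(nat \<Rightarrow> real) \<Rightarrow> nat \<Rightarrow> real \<Rightarrow> real" where
  "total_delay x i t = (if i = 0 then 0 else max 0 (x i - min_cost C t))"

lemma multiplier_sums:
  assumes opt: "short_term_optimum C q p lam" and pos: "positivity_convexity C q p"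
  shows "\<exists>x. (\<forall>i\<in>locs C. AE h in ratio_measure. 0 < workers C i h \<longrightarrow> lam i h = h * x i) \<and>
     (\<forall>i. 1 \<le> i \<and> i < loc_count C \<longrightarrow> x i < x (Suc i)) \<and>
     (AE t in time_measure C. \<forall>i\<le>loc_count C. (\<Sum>j\<in>{1..i}. p j t) = total_delay x i t)"
proof -
  have "\<forall>i\<in>locs C. \<exists>x. (AE h in ratio_measure. 0 < workers C i h \<longrightarrow> lam i h = h * x) \<and>
     (AE t in time_measure C. x \<le> min_cost C t + (\<Sum>j\<in>{1..i}. p j t)) \<and>
     (AE t in time_measure C. 0 < p i t \<longrightarrow> min_cost C t + (\<Sum>j\<in>{1..i}. p j t) = x)"
    using critical_cost[OF opt pos] by (intro ballI)
  from bchoice[OF this] obtain x where x: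
    "\<And>i. i \<in> locs C \<Longrightarrow> AE h in ratio_measure. 0 < workers C i h \<longrightarrow> lam i h = h * x i"
    "\<And>i. i \<in> locs C \<Longrightarrow> AE t in time_measure C. x i \<le> min_cost C t + (\<Sum>j\<in>{1..i}. p j t)"
    "\<And>i. i \<in> locs C \<Longrightarrow> AE t in time_measure C.
       0 < p i t \<longrightarrow> min_cost C t + (\<Sum>j\<in>{1..i}. p j t) = x i"
    by (elim exE) blast
  have less: "x i < x (Suc i)" if "1 \<le> i" "i < loc_count C" for i
  proof -
    have i: "i \<in> locs C" "Suc i \<in> locs C"
      using that by (auto simp: locs_def)
    \<comment> \<open>Where \<open>p (Suc i) t > 0\<close>, the cost \<open>x (Suc i)\<close>
      exceeds \<open>min_cost C t + (\<Sum>j\<in>{1..i}. p j t)\<close> by that amount, and the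
      latter is at least \<open>x i\<close>.\<close>
    from x(2)[OF i(1)] x(3)[OF i(2)]
    have "AE t in time_measure C. 0 < p (Suc i) t \<longrightarrow> x i < x (Suc i)"
      by eventually_elim auto
    from ex_multiplier_pos[OF opt pos i(2) this] show ?thesis
      by blast
  qed
  have "AE t in time_measure C. \<forall>i\<in>locs C. 0 \<le> p i t \<and> x i \<le> min_cost C t + (\<Sum>j\<in>{1..i}. p j t) \<and>
      (0 < p i t \<longrightarrow> min_cost C t + (\<Sum>j\<in>{1..i}. p j t) = x i)"
  proof (intro AE_finite_allI)
    fix i assume i: "i \<in> locs C"
    have "AE t in time_measure C. 0 \<le> p i t \<and> (0 < p i t \<longrightarrow> bottleneck_flow C q i t = cap C i)"
      using opt i by (simp add: short_term_optimum_def)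
    with x(2,3)[OF i] show "AE t in time_measure C. 0 \<le> p i t \<and>
       x i \<le> min_cost C t + (\<Sum>j\<in>{1..i}. p j t) \<and>
      (0 < p i t \<longrightarrow> min_cost C t + (\<Sum>j\<in>{1..i}. p j t) = x i)"
      by eventually_elim blast
  qed (simp add: locs_def)
  then have "AE t in time_measure C. \<forall>i\<le>loc_count C. (\<Sum>j\<in>{1..i}. p j t) = total_delay x i t"
  proof eventually_elim
    case (elim t)
    show ?case
    proof (intro allI impI)
      fix i assume "i \<le> loc_count C"
      then show "(\<Sum>j\<in>{1..i}. p j t) = total_delay x i t"
      proof (induction i)
        case (Suc i)
        then have "Suc i \<in> locs C"
          by (simp add: locs_def)
        with elim have "0 \<le> p (Suc i) t" "x (Suc i) \<le> min_cost C t + (\<Sum>j\<in>{1..Suc i}. p j t)"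
          "0 < p (Suc i) t \<longrightarrow> min_cost C t + (\<Sum>j\<in>{1..Suc i}. p j t) = x (Suc i)"
          by blast+
        moreover have "(\<Sum>j\<in>{1..Suc i}. p j t) = total_delay x i t + p (Suc i) t"
          using Suc by simp
        moreover have "0 \<le> total_delay x i t"
          by (simp add: total_delay_def)
        \<comment> \<open>This settles the case \<open>p (Suc i) t = 0\<close>: the unchanged sum is
          at most the new positive part, and it is at least that by the lower bounds.\<close>
        moreover have "total_delay x i t \<le> max 0 (x (Suc i) - min_cost C t)"
          using less[of i] Suc.prems by (auto simp: total_delay_def)
        ultimately show ?case
          by (auto simp: total_delay_def[of _ "Suc i"])
      qed (simp add: total_delay_def)
    qed
  qed
  with x(1) less show ?thesis by blast
qed

section \<open>Null sets and continuous versions on the arrival interval\<close>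

lemma AE_pair_snd:
  assumes "AE t in time_measure C. P t"
  shows "AE (h, t) in ratio_measure \<Otimes>\<^sub>M time_measure C. P t"
proof -
  obtain N where N: "N \<in> sets (time_measure C)" "emeasure (time_measure C) N = 0"
      "{t \<in> space (time_measure C). \<not> P t} \<subseteq> N"
    using assms unfolding eventually_ae_filter by auto
  have "AE t in time_measure C. t \<notin> N"
    using N(1,2) by (intro AE_not_in) (auto simp: null_sets_def)
  then have "AE z in ratio_measure \<Otimes>\<^sub>M time_measure C. snd z \<notin> N"
    using N(1) by (intro AE_pair_measure) simp_all
  then show ?thesis
    using AE_space by eventually_elim (use N(3) in \<open>auto simp: space_pair_measure\<close>)
qed

text \<open>A difference at \<open>t\<close> would persist on a relative neighbourhood, which has
  positive measure even at an endpoint. Derivatives of departure times thus do not depend on the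
  chosen continuous version, except possibly at the two endpoints.\<close>

lemma continuous_on_arrivals_AE_eq:
  assumes f: "continuous_on (arrivals C) f" and g: "continuous_on (arrivals C) g"
    and eq: "AE t in time_measure C. f t = g t" and t: "t \<in> arrivals C"
  shows "f t = (g t :: real)"
proof (rule ccontr)
  assume neq: "f t \<noteq> g t"
  have "continuous_on (arrivals C) (\<lambda>s. \<bar>f s - g s\<bar>)"
    using f g by (intro continuous_intros)
  then obtain d where d: "0 < d"
      "\<And>s. s \<in> arrivals C \<Longrightarrow> dist s t < d \<Longrightarrow> dist \<bar>f s - g s\<bar> \<bar>f t - g t\<bar> < \<bar>f t - g t\<bar>"
    using t neq unfolding continuous_on_iff by (metis zero_less_abs_iff right_minus_eq)
  have "AE s in lborel. \<not> (s \<in> arrivals C \<and> dist s t < d)"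
    using eq unfolding AE_time_measure
  proof eventually_elim
    case (elim s)
    then show ?case
      using d(2)[of s] by (auto simp: dist_real_def)
  qed
  then have "emeasure lborel {s \<in> arrivals C. dist s t < d} = 0"
    using emeasure_eq_0_AE[of "\<lambda>s. s \<in> arrivals C \<and> dist s t < d" lborel] by simp
  then show False
    using emeasure_Icc_Int_ball_pos[OF t_first_less_t_last _ d(1), of t] t by (simp add: arrivals_def)
qed

lemma arrival_window_cong_AE:
  assumes [measurable]: "f i \<in> borel_measurable (time_measure C)" "g i \<in> borel_measurable (time_measure C)"
    and eq: "AE t in time_measure C. f i t = g i t"
  shows "arrival_window C f i = arrival_window C g i"
proof -
  have meas: "{s \<in> arrivals C. dist s t < e \<and> f s \<noteq> 0} \<in> sets lborel"
    if [measurable]: "f \<in> borel_measurable (time_measure C)" for f :: "real \<Rightarrow> real" and e t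
  proof -
    have [measurable]: "(\<lambda>s. s) \<in> borel_measurable (time_measure C)"
      unfolding time_measure_def by (intro measurable_restrict_space1) simp
    have "{s \<in> space (time_measure C). dist s t < e \<and> f s \<noteq> 0} \<in> sets (time_measure C)"
      by measurable
    moreover have "arrivals C \<in> sets lborel"
      by (simp add: arrivals_def)
    ultimately show ?thesis
      unfolding space_time_measure by (auto simp: time_measure_def sets_restrict_space_iff)
  qed
  have "emeasure lborel {s \<in> arrivals C. dist s t < e \<and> f i s \<noteq> 0}
      = emeasure lborel {s \<in> arrivals C. dist s t < e \<and> g i s \<noteq> 0}" for t e
    using eq unfolding AE_time_measure
    by (intro emeasure_eq_AE meas assms(1,2)) (auto elim!: eventually_mono)
  then show ?thesis
    unfolding arrival_window_def by simp
qed

lemma total_delay_lipschitz: "\<exists>L. L-lipschitz_on (arrivals C) (total_delay x i)"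
proof (cases "i = 0")
  case True
  then have "total_delay x i = (\<lambda>_. 0)"
    by (simp add: total_delay_def fun_eq_iff)
  then show ?thesis
    using lipschitz_on_constant[of "arrivals C"] by auto
next
  case False
  obtain L where "L-lipschitz_on (arrivals C) (min_cost C)"
    using min_cost_lipschitz unfolding arrivals_def by blast
  then have "(0 + L)-lipschitz_on (arrivals C) (\<lambda>t. x i - min_cost C t)"
    by (intro lipschitz_on_diff lipschitz_on_constant)
  then have "(0 + L)-lipschitz_on (arrivals C) (\<lambda>t. max 0 (x i - min_cost C t))"
    by (rule lipschitz_on_pos_part)
  moreover have "total_delay x i = (\<lambda>t. max 0 (x i - min_cost C t))"
    using False by (simp add: total_delay_def fun_eq_iff)
  ultimately show ?thesis by auto
qed

section \<open>The equilibrium\<close>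

context
  fixes x :: "nat \<Rightarrow> real" and w :: "nat \<Rightarrow> real \<Rightarrow> real"
  assumes x_less: "\<And>i. 1 \<le> i \<Longrightarrow> i < loc_count C \<Longrightarrow> x i < x (Suc i)"
    and w_eq: "\<And>i t. i \<in> locs C \<Longrightarrow> t \<in> arrivals C \<Longrightarrow> w i t = total_delay x i t - total_delay x (i - 1) t"
begin

lemma delay_sum:
  assumes "i \<le> loc_count C" "t \<in> arrivals C"
  shows "(\<Sum>j\<in>{1..i}. w j t) = total_delay x i t"
  using assms(1)
proof (induction i)
  case (Suc i)
  then show ?case
    using w_eq[of "Suc i" t] assms(2) by (simp add: locs_def)
qed (simp add: total_delay_def)

text \<open>If \<open>min_cost C t < x i\<close>, the positive part at \<open>x i\<close> exceeds
  the one at the smaller \<open>x (i - 1)\<close>; otherwise both vanish. For \<open>i = 1\<close>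
  the subtracted term is 0.\<close>

lemma
  assumes "i \<in> locs C" "t \<in> arrivals C"
  shows delay_nonneg: "0 \<le> w i t" and delay_pos_iff: "0 < w i t \<longleftrightarrow> min_cost C t < x i"
proof -
  have "x (i - 1) < x i" if "i \<noteq> 1"
    using x_less[of "i - 1"] assms(1) that by (auto simp: locs_def)
  then show "0 \<le> w i t" "0 < w i t \<longleftrightarrow> min_cost C t < x i"
    using w_eq[OF assms] assms(1) by (auto simp: total_delay_def locs_def)
qed

lemma delay_neq_0_iff: "i \<in> locs C \<Longrightarrow> t \<in> arrivals C \<Longrightarrow> w i t \<noteq> 0 \<longleftrightarrow> min_cost C t < x i"
  using delay_nonneg[of i t] delay_pos_iff[of i t] by auto

text \<open>Where \<open>min_cost C\<close> exceeds \<open>x i\<close>, continuity keeps the delay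
  zero on a whole ball. The window is closed, so only the weak inequality can be expected; together
  with \<open>in_arrival_window\<close> it leaves just the level set of \<open>x i\<close>
  undecided, which is null.\<close>

lemma arrival_window_subset:
  assumes i: "i \<in> locs C" and t: "t \<in> arrival_window C w i"
  shows "min_cost C t \<le> x i"
proof (rule ccontr)
  assume "\<not> ?thesis"
  then have "eventually (\<lambda>s. x i < min_cost C s) (nhds t)"
    using min_cost_isCont[of t] order_tendstoD(1)[of "min_cost C" "min_cost C t" "nhds t" "x i"]
    by (simp add: continuous_within tendsto_nhds_iff not_le)
  then obtain e where e: "0 < e" "\<And>s. dist s t < e \<Longrightarrow> x i < min_cost C s"
    unfolding eventually_nhds_metric by blast
  then have "{s \<in> arrivals C. dist s t < e \<and> w i s \<noteq> 0} = {}"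
    using delay_neq_0_iff[OF i] by force
  moreover have "0 < emeasure lborel {s \<in> arrivals C. dist s t < e \<and> w i s \<noteq> 0}"
    using t e(1) by (simp add: arrival_window_def)
  ultimately show False
    by (metis emeasure_empty less_irrefl)
qed

lemma in_arrival_window:
  assumes i: "i \<in> locs C" and t: "t \<in> arrivals C" and less: "min_cost C t < x i"
  shows "t \<in> arrival_window C w i"
  unfolding arrival_window_def
proof (intro CollectI conjI allI impI t)
  fix e :: real assume e: "0 < e"
  have "eventually (\<lambda>s. min_cost C s < x i) (nhds t)"
    using less min_cost_isCont[of t] order_tendstoD(2)[of "min_cost C" "min_cost C t" "nhds t" "x i"]
    by (simp add: continuous_within tendsto_nhds_iff)
  then obtain d where d: "0 < d" "\<And>s. dist s t < d \<Longrightarrow> min_cost C s < x i"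
    unfolding eventually_nhds_metric by blast
  have "0 < emeasure lborel {s \<in> arrivals C. dist s t < min d e}"
    using emeasure_Icc_Int_ball_pos[OF t_first_less_t_last, of t "min d e"] t d(1) e
    by (simp add: arrivals_def)
  also have "\<dots> \<le> emeasure lborel {s \<in> arrivals C. dist s t < e \<and> w i s \<noteq> 0}"
  proof (rule emeasure_mono)
    show "{s \<in> arrivals C. dist s t < min d e} \<subseteq> {s \<in> arrivals C. dist s t < e \<and> w i s \<noteq> 0}"
      using d(2) delay_neq_0_iff[OF i] by auto
    have "{s \<in> arrivals C. dist s t < e \<and> w i s \<noteq> 0} = {s \<in> {t_first C..t_last C}. dist s t < e \<and> min_cost C s < x i}"
      using delay_neq_0_iff[OF i] by (auto simp: arrivals_def)
    also have "\<dots> \<in> sets lborel"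
      by measurable
    finally show "{s \<in> arrivals C. dist s t < e \<and> w i s \<noteq> 0} \<in> sets lborel" .
  qed
  finally show "0 < emeasure lborel {s \<in> arrivals C. dist s t < e \<and> w i s \<noteq> 0}" .
qed

lemma delay_lipschitz:
  assumes "i \<in> locs C"
  shows "\<exists>L. L-lipschitz_on (arrivals C) (w i)"
proof -
  obtain L M where "L-lipschitz_on (arrivals C) (total_delay x i)"
      "M-lipschitz_on (arrivals C) (total_delay x (i - 1))"
    using total_delay_lipschitz by blast
  then have "(L + M)-lipschitz_on (arrivals C) (\<lambda>t. total_delay x i t - total_delay x (i - 1) t)"
    by (rule lipschitz_on_diff)
  then have "(L + M)-lipschitz_on (arrivals C) (w i)"
    using w_eq[OF assms] by (subst lipschitz_on_cong) auto
  then show ?thesis ..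
qed

text \<open>Bottleneck \<open>Suc j\<close> sees only the delays up to \<open>j\<close>, hence the
  shift of index. Off the level of \<open>x j\<close>, the positive part is locally either 0 or
  \<open>x j - min_cost C s\<close>.\<close>

lemma departure_time_derivative:
  assumes t: "t \<in> {t_first C<..<t_last C}" and diff: "min_cost C differentiable (at t)"
    and j: "j \<le> loc_count C" and neq: "j \<noteq> 0 \<Longrightarrow> min_cost C t \<noteq> x j"
  shows "departure_time C w (Suc j) differentiable (at t)"
    and "j = 0 \<or> x j \<le> min_cost C t \<Longrightarrow> deriv (departure_time C w (Suc j)) t = 1"
proof -
  define K where "K = (\<Sum>j\<in>{1..<Suc j}. free_flow C j)"
  \<comment> \<open>The delays are known only on the arrival interval, so a two-sided derivative
    requires \<open>t\<close> in its interior.\<close>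
  have "eventually (\<lambda>s. s \<in> {t_first C<..<t_last C}) (nhds t)"
    using t by (intro eventually_nhds_in_open) auto
  then have dep: "eventually (\<lambda>s. departure_time C w (Suc j) s = s - total_delay x j s - K) (nhds t)"
  proof eventually_elim
    case (elim s)
    then have "(\<Sum>i\<in>{1..j}. w i s) = total_delay x j s"
      using j by (intro delay_sum) (auto simp: arrivals_def)
    then show ?case
      by (simp add: departure_time_def K_def sum.distrib atLeastLessThanSuc_atLeastAtMost)
  qed
  have cont: "(min_cost C \<longlongrightarrow> min_cost C t) (nhds t)"
    using min_cost_isCont[of t] by (simp add: continuous_within tendsto_nhds_iff)
  have one: "(departure_time C w (Suc j) has_real_derivative 1) (at t)" if "j = 0 \<or> x j \<le> min_cost C t"
  proof -
    have "eventually (\<lambda>s. total_delay x j s = 0) (nhds t)"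
    proof (cases "j = 0")
      case False
      then have "eventually (\<lambda>s. x j < min_cost C s) (nhds t)"
        using that neq by (intro order_tendstoD(1)[OF cont]) simp
      then show ?thesis
        by eventually_elim (simp add: total_delay_def)
    qed (simp add: total_delay_def)
    with dep have ev: "eventually (\<lambda>s. departure_time C w (Suc j) s = s - K) (nhds t)"
      by eventually_elim simp
    have "((\<lambda>s. s - K) has_real_derivative 1) (at t)"
      by (auto intro!: derivative_eq_intros)
    then show ?thesis
      unfolding DERIV_cong_ev[OF refl ev refl] .
  qed
  show "deriv (departure_time C w (Suc j)) t = 1" if "j = 0 \<or> x j \<le> min_cost C t"
    using one[OF that] by (rule DERIV_imp_deriv)
  show "departure_time C w (Suc j) differentiable (at t)"
  proof (cases "j = 0 \<or> x j \<le> min_cost C t")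
    case True
    then show ?thesis
      using one real_differentiable_def by blast
  next
    case False
    have "eventually (\<lambda>s. min_cost C s < x j) (nhds t)"
      using False by (intro order_tendstoD(2)[OF cont]) simp
    with dep have ev: "eventually (\<lambda>s. departure_time C w (Suc j) s = s - (x j - min_cost C s) - K) (nhds t)"
      by eventually_elim (use False in \<open>simp add: total_delay_def\<close>)
    obtain D where "(min_cost C has_real_derivative D) (at t)"
      using diff real_differentiable_def by blast
    then have "((\<lambda>s. s - (x j - min_cost C s) - K) has_real_derivative (1 + D)) (at t)"
      by (auto intro!: derivative_eq_intros)
    then have "(departure_time C w (Suc j) has_real_derivative (1 + D)) (at t)"
      unfolding DERIV_cong_ev[OF refl ev refl] .
    then show ?thesis
      using real_differentiable_def by blast
  qed
qed

text \<open>At almost every time exactly one preferred time is best, so the sum over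
  \<open>k\<close> has at most one nonzero term.\<close>

lemma AE_commute_flow_sum:
  assumes q: "equilibrium_flow C w q"
  shows "AE t in time_measure C. \<forall>i\<in>locs C. (\<Sum>k\<in>prefs C. commute_flow C q i k t) =
      (if min_cost C t < x i
       then cap C i * deriv (departure_time C w i) t - cap C (Suc i) * deriv (departure_time C w (Suc i)) t
       else 0)"
proof -
  let ?f = "\<lambda>i t. cap C i * deriv (departure_time C w i) t - cap C (i + 1) * deriv (departure_time C w (i + 1)) t"
  have flow: "AE t in time_measure C. \<forall>i\<in>locs C. \<forall>k\<in>prefs C. commute_flow C q i k t =
      (if t \<in> arrival_window C w i \<inter> best_times C k then ?f i t else 0)"
    using q by (intro AE_finite_allI finite_prefs) (auto simp: equilibrium_flow_def locs_def)
  have "AE t in time_measure C. \<forall>i\<in>locs C. min_cost C t \<noteq> x i"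
    by (intro AE_finite_allI AE_min_cost_neq) (simp add: locs_def)
  with flow AE_best_times_unique show ?thesis
    using AE_space
  proof eventually_elim
    case (elim t)
    show ?case
    proof
      fix i assume i: "i \<in> locs C"
      have t: "t \<in> arrivals C"
        using elim(4) by (simp add: space_time_measure)
      obtain k0 where k0: "k0 \<in> prefs C" "min_cost C t = sched_cost C k0 t"
        using min_cost_attained by blast
      have best: "t \<in> best_times C k \<longleftrightarrow> k = k0" if "k \<in> prefs C" for k
        using elim(2) k0 t that by (auto simp: best_times_def)
      have window: "t \<in> arrival_window C w i \<longleftrightarrow> min_cost C t < x i"
        using arrival_window_subset[OF i, of t] in_arrival_window[OF i t] elim(3) i by force
      have "(\<Sum>k\<in>prefs C. commute_flow C q i k t) =
          (\<Sum>k\<in>prefs C. if k = k0 then if min_cost C t < x i then ?f i t else 0 else 0)"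
        using elim(1) i by (intro sum.cong) (auto simp: best window)
      also have "\<dots> = (if min_cost C t < x i then ?f i t else 0)"
        using k0(1) finite_prefs by simp
      finally show "(\<Sum>k\<in>prefs C. commute_flow C q i k t) =
          (if min_cost C t < x i
           then cap C i * deriv (departure_time C w i) t - cap C (Suc i) * deriv (departure_time C w (Suc i)) t
           else 0)"
        by simp
    qed
  qed
qed

lemma AE_bottleneck:
  assumes q: "equilibrium_flow C w q" and i: "i \<in> locs C"
  shows "AE t in time_measure C. departure_time C w i differentiable (at t) \<and>
        bottleneck_flow C q i t \<le> cap C i * deriv (departure_time C w i) t \<and>
        (0 < w i t \<longrightarrow> bottleneck_flow C q i t = cap C i * deriv (departure_time C w i) t)"
proof -
  have "AE t in time_measure C. \<forall>i\<in>locs C. min_cost C t \<noteq> x i"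
    by (intro AE_finite_allI AE_min_cost_neq) (simp add: locs_def)
  with AE_commute_flow_sum[OF q] AE_min_cost_differentiable AE_interior_arrivals show ?thesis
  proof eventually_elim
    case (elim t)
    let ?d = "\<lambda>j. deriv (departure_time C w j) t"
    have derivative: "departure_time C w (Suc j) differentiable (at t)"
      "j = 0 \<or> x j \<le> min_cost C t \<Longrightarrow> ?d (Suc j) = 1" if "j \<le> loc_count C" for j
      using departure_time_derivative[OF elim(3,2) that] elim(4) that by (auto simp: locs_def)
    have "bottleneck_flow C q i t = (\<Sum>j\<in>{i..loc_count C}.
        if min_cost C t < x j then cap C j * ?d j - cap C (Suc j) * ?d (Suc j) else 0)"
      unfolding bottleneck_flow_def using elim(1) i by (intro sum.cong) (auto simp: locs_def)
    moreover have "(\<Sum>j\<in>{i..loc_count C}.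
        if min_cost C t < x j then cap C j * ?d j - cap C (Suc j) * ?d (Suc j) else 0) \<le> cap C i * ?d i \<and>
      (i \<le> loc_count C \<longrightarrow> min_cost C t < x i \<longrightarrow> (\<Sum>j\<in>{i..loc_count C}.
        if min_cost C t < x j then cap C j * ?d j - cap C (Suc j) * ?d (Suc j) else 0) = cap C i * ?d i)"
    \<comment> \<open>A bottleneck counts as open when \<open>min_cost C t < x j\<close>; openness
      passes outward because \<open>x\<close> increases.\<close>
    proof (rule telescoping_bottleneck_bound)
      show "i \<le> Suc (loc_count C)" "1 \<le> i"
        using i by (auto simp: locs_def)
      show "cap C (Suc (loc_count C)) = 0"
        using valid by (simp add: valid_corridor_def)
      fix j assume j: "j \<in> {1..loc_count C}"
      have "\<forall>j\<in>locs C. cap C (j + 1) < cap C j"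
        using valid unfolding valid_corridor_def by blast
      then show "cap C (Suc j) \<le> cap C j"
        using j by (simp add: locs_def less_imp_le)
    next
      fix j assume "j \<in> {1..<loc_count C}" "min_cost C t < x j"
      then show "min_cost C t < x (Suc j)"
        using x_less[of j] by auto
    next
      fix j assume j: "j \<in> {1..loc_count C}" "\<not> min_cost C t < x j"
      \<comment> \<open>The departure time from \<open>j\<close> involves the total delay of
        \<open>j - 1\<close>, that from \<open>Suc j\<close> the total delay of \<open>j\<close>;
        both must vanish near \<open>t\<close> for the two rates to be 1.\<close>
      have "x (j - 1) < x j" if "j \<noteq> 1"
        using x_less[of "j - 1"] j(1) that by auto
      then have "j - 1 = 0 \<or> x (j - 1) \<le> min_cost C t"
        using j by fastforce
      then show "?d j = 1 \<and> ?d (Suc j) = 1"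
        using derivative(2)[of j] derivative(2)[of "j - 1"] j by auto
    qed
    moreover have "0 < w i t \<longleftrightarrow> min_cost C t < x i"
      using elim(3) by (intro delay_pos_iff i) (auto simp: arrivals_def)
    ultimately show ?case
      using derivative(1)[of "i - 1"] i by (auto simp: locs_def)
  qed
qed

text \<open>The inequality is inherited from the optimum, as the total delays agree almost
  everywhere. Equality where the flow is positive comes from its support: there \<open>k\<close> is
  best, \<open>t\<close> lies in the window and the ratio has workers, so both sides equal
  \<open>h * x i\<close>.\<close>

lemma equilibrium_cost_condition:
  assumes q: "equilibrium_flow C w q" and cost: "cost_condition C q' p lam"
    and lam: "\<And>i. i \<in> locs C \<Longrightarrow> lam i \<in> borel_measurable ratio_measure"
    and lam_eq: "\<And>i. i \<in> locs C \<Longrightarrow> AE h in ratio_measure. 0 < workers C i h \<longrightarrow> lam i h = h * x i"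
    and p_sum: "AE t in time_measure C. \<forall>i\<le>loc_count C. (\<Sum>j\<in>{1..i}. p j t) = total_delay x i t"
  shows "cost_condition C q w lam"
  unfolding cost_condition_def
proof (intro ballI)
  fix i k assume i: "i \<in> locs C" and k: "k \<in> prefs C"
  have "AE (h, t) in ratio_measure \<Otimes>\<^sub>M time_measure C. lam i h \<le> h * (sched_cost C k t + (\<Sum>j\<in>{1..i}. p j t)) \<and>
     (0 < q' i k h t \<longrightarrow> h * (sched_cost C k t + (\<Sum>j\<in>{1..i}. p j t)) = lam i h)"
    using cost i k unfolding cost_condition_def ratio_time_measure_def by blast
  moreover have "AE (h, t) in ratio_measure \<Otimes>\<^sub>M time_measure C.
      t \<notin> arrival_window C w i \<inter> best_times C k \<longrightarrow> q i k h t = 0"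
    using q i k unfolding equilibrium_flow_def ratio_time_measure_def by blast
  moreover have "AE (h, t) in ratio_measure \<Otimes>\<^sub>M time_measure C. 0 < q i k h t \<longrightarrow> lam i h = h * x i"
    using q i k by (intro AE_flow_pos_ratio lam lam_eq) (auto simp: equilibrium_flow_def)
  ultimately show "AE (h, t) in ratio_time_measure C. lam i h \<le> h * (sched_cost C k t + (\<Sum>j\<in>{1..i}. w j t)) \<and>
     (0 < q i k h t \<longrightarrow> h * (sched_cost C k t + (\<Sum>j\<in>{1..i}. w j t)) = lam i h)"
    unfolding ratio_time_measure_def using AE_pair_snd[OF p_sum] AE_space
  proof eventually_elim
    case (elim z)
    obtain h t where z: "z = (h, t)"
      by force
    have t: "t \<in> arrivals C"
      using elim(5) z by (simp add: space_pair_measure space_time_measure)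
    have i': "i \<le> loc_count C" "i \<noteq> 0"
      using i by (auto simp: locs_def)
    have sums: "(\<Sum>j\<in>{1..i}. p j t) = total_delay x i t" "(\<Sum>j\<in>{1..i}. w j t) = total_delay x i t"
      using elim(4) z i' delay_sum[OF i'(1) t] by auto
    have "h * (sched_cost C k t + total_delay x i t) = lam i h" if "0 < q i k h t"
    proof -
      have window: "t \<in> arrival_window C w i" "t \<in> best_times C k" and lam_h: "lam i h = h * x i"
        using elim(2,3) z that by auto
      \<comment> \<open>The weak inequality for the window suffices: if
        \<open>min_cost C t = x i\<close>, the positive part is 0 and the cost is still
        \<open>x i\<close>.\<close>
      then show ?thesis
        using arrival_window_subset[OF i window(1)] i'(2)
        by (simp add: best_times_def total_delay_def)
    qed
    then show ?case
      using elim(1) z sums by simp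
  qed
qed

end

end

theorem proposition3p2:
  fixes C :: corridor
    and qSO :: flow
    and pSO lamSO :: "nat \<Rightarrow> real \<Rightarrow> real"
  assumes corridor: "valid_corridor C"
    and optimum: "short_term_optimum C qSO pSO lamSO"
    and positivity: "positivity_convexity C qSO pSO"
    and slope: "\<And>k i t d. \<lbrakk>k \<in> prefs C; i \<in> locs C; t \<in> arrivals C;
        (sched_cost C k has_real_derivative d) (at t)\<rbrakk> \<Longrightarrow>
        -1 < d \<and> (i < loc_count C \<longrightarrow> d < (cap C i - cap C (i + 1)) / cap C (i + 1))"
  shows "(\<exists>wUE. continuous_version C pSO wUE) \<and>
         (\<forall>wUE. continuous_version C pSO wUE \<longrightarrow>
           (\<forall>i\<in>locs C. arrival_window C wUE i = arrival_window C pSO i) \<and>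
           (\<forall>qUE. equilibrium_flow C wUE qUE \<longrightarrow>
              short_term_equilibrium C qUE wUE lamSO))"
proof -
  interpret valid_corridor_loc C
    by unfold_locales (rule corridor)
  obtain x where lam_eq: "\<And>i. i \<in> locs C \<Longrightarrow>
        AE h in ratio_measure. 0 < workers C i h \<longrightarrow> lamSO i h = h * x i"
    and x_less: "\<And>i. 1 \<le> i \<Longrightarrow> i < loc_count C \<Longrightarrow> x i < x (Suc i)"
    and p_sum: "AE t in time_measure C. \<forall>i\<le>loc_count C. (\<Sum>j\<in>{1..i}. pSO j t) = total_delay x i t"
    using multiplier_sums[OF optimum positivity] by blast
  \<comment> \<open>Differences of consecutive total delays recover the single multipliers, now as
    continuous functions.\<close>
  define w0 where "w0 i t = total_delay x i t - total_delay x (i - 1) t" for i t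
  have w0_cont: "continuous_on (arrivals C) (w0 i)" for i
  proof -
    have "continuous_on (arrivals C) (total_delay x i)" for i
      using total_delay_lipschitz lipschitz_on_continuous_on by blast
    then show ?thesis
      unfolding w0_def by (intro continuous_intros)
  qed
  have w0_eq: "AE t in time_measure C. w0 i t = pSO i t" if "i \<in> locs C" for i
    using p_sum
  proof eventually_elim
    case (elim t)
    obtain j where j: "i = Suc j" "j < loc_count C"
      using \<open>i \<in> locs C\<close> by (cases i) (auto simp: locs_def)
    then show ?case
      using elim[rule_format, of "Suc j"] elim[rule_format, of j] by (simp add: w0_def)
  qed
  have "continuous_version C pSO w0"
    using w0_cont w0_eq by (simp add: continuous_version_def)
  moreover have "arrival_window C w i = arrival_window C pSO i"
    if w: "continuous_version C pSO w" and i: "i \<in> locs C" for w i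
  proof (rule arrival_window_cong_AE)
    show "AE t in time_measure C. w i t = pSO i t"
      using w i by (simp add: continuous_version_def)
    show "pSO i \<in> borel_measurable (time_measure C)"
      using optimum i by (simp add: short_term_optimum_def)
    have "w i \<in> borel_measurable (restrict_space borel (arrivals C))"
      using w i by (intro borel_measurable_continuous_on_restrict) (simp add: continuous_version_def)
    then show "w i \<in> borel_measurable (time_measure C)"
      using sets_time_measure measurable_cong_sets by blast
  qed
  moreover have "short_term_equilibrium C q w lamSO"
    if w: "continuous_version C pSO w" and q: "equilibrium_flow C w q" for w q
  proof -
    \<comment> \<open>An arbitrary continuous version agrees with \<open>w0\<close> at every arrival
      time, not merely almost everywhere.\<close>
    have w_eq: "w i t = total_delay x i t - total_delay x (i - 1) t"
      if i: "i \<in> locs C" and t: "t \<in> arrivals C" for i t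
    proof -
      have "AE t in time_measure C. w i t = pSO i t"
        using w i by (simp add: continuous_version_def)
      with w0_eq[OF i] have "AE t in time_measure C. w i t = w0 i t"
        by eventually_elim simp
      then show ?thesis
        using continuous_on_arrivals_AE_eq[of "w i" "w0 i" t] w w0_cont i t
        by (simp add: continuous_version_def w0_def)
    qed
    note delays = x_less w_eq
    show ?thesis
      unfolding short_term_equilibrium_def
    proof (intro conjI ballI)
      show "nonneg_flow C q" "conserves_workers C q"
        using q by (auto simp: equilibrium_flow_def)
      show "cost_condition C q w lamSO"
        using optimum by (intro equilibrium_cost_condition[OF delays q _ _ lam_eq p_sum, of qSO])
          (auto simp: short_term_optimum_def)
      fix i assume i: "i \<in> locs C"
      show "abs_continuous_on (arrivals C) (w i)"
        using delay_lipschitz[OF delays i] abs_continuous_on_lipschitz by blast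
      show "lamSO i \<in> borel_measurable ratio_measure"
        using optimum i by (simp add: short_term_optimum_def)
      show "AE t in time_measure C. departure_time C w i differentiable (at t) \<and>
          bottleneck_flow C q i t \<le> cap C i * deriv (departure_time C w i) t \<and>
          (0 < w i t \<longrightarrow> bottleneck_flow C q i t = cap C i * deriv (departure_time C w i) t)"
        using AE_bottleneck[OF delays q i] .
      show "0 \<le> w i t" if "t \<in> arrivals C" for t
        using delay_nonneg[OF delays i that] .
    qed
  qed
  ultimately show ?thesis by blast
qed

end
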